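(* Let $V$ be a finite-dimensional real vector space equipped with a seminorm $|\cdot|_V$, and assume that either $\dim V\le 2$ or $|\cdot|_V$ is a Euclidean norm. Let $\Sigma$ be a $\sigma$-algebra on a set $X$ and let $\nu,\mu:\Sigma\to V$ be vector measures with $\mathcal{R}(\nu)\subseteq\mathcal{R}(\mu)$. Then $|\nu|_V(X)\le|\mu|_V(X)$. If moreover $|\cdot|_V$ is a strictly convex norm, then $|\nu|_V(X)=|\mu|_V(X)$ holds if and only if $\mathcal{R}(\nu)=\mathcal{R}(\mu)$.
   Context: A vector measure is a countably additive map $\mu:\Sigma\to V$. Total variation: $|\mu|_V(A)=\sup\{\sum_{i=1}^m|\mu(E_i)|_V : E_1,\dots,E_m\in\Sigma \text{ pairwise disjoint subsets of } A\}$. Range: $\mathcal{R}(\mu)=\overline{\mathrm{conv}}\{\mu(E):E\in\Sigma\}$ (closed convex hull). A norm is strictly convex if $|v+w|_V<|v|_V+|w|_V$ for all linearly independent $v,w$. *)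

theory Defs
  imports "HOL-Analysis.Analysis"
begin

definition is_seminorm :: "('v::real_vector \<Rightarrow> real) \<Rightarrow> bool" where
  "is_seminorm p \<longleftrightarrow> (\<forall>x y. p (x + y) \<le> p x + p y) \<and> (\<forall>c x. p (c *\<^sub>R x) = \<bar>c\<bar> * p x)"

definition is_norm_fun :: "('v::real_vector \<Rightarrow> real) \<Rightarrow> bool" where
  "is_norm_fun p \<longleftrightarrow> is_seminorm p \<and> (\<forall>x. p x = 0 \<longrightarrow> x = 0)"

definition is_euclidean_norm :: "('v::real_vector \<Rightarrow> real) \<Rightarrow> bool" where
  "is_euclidean_norm p \<longleftrightarrow> (\<exists>B :: 'v \<Rightarrow> 'v \<Rightarrow> real. bilinear B \<and> (\<forall>x y. B x y = B y x)
      \<and> (\<forall>x. x \<noteq> 0 \<longrightarrow> B x x > 0) \<and> (\<forall>x. p x = sqrt (B x x)))"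

definition strictly_convex_norm :: "('v::real_vector \<Rightarrow> real) \<Rightarrow> bool" where
  "strictly_convex_norm p \<longleftrightarrow> is_norm_fun p \<and>
     (\<forall>v w. (\<forall>a b. a *\<^sub>R v + b *\<^sub>R w = 0 \<longrightarrow> a = 0 \<and> b = 0) \<longrightarrow> p (v + w) < p v + p w)"

definition vector_measure :: "'a measure \<Rightarrow> ('a set \<Rightarrow> 'v::real_normed_vector) \<Rightarrow> bool" where
  "vector_measure M \<mu> \<longleftrightarrow> (\<forall>A :: nat \<Rightarrow> 'a set. range A \<subseteq> sets M \<longrightarrow> disjoint_family A \<longrightarrow>
      (\<lambda>n. \<mu> (A n)) sums \<mu> (\<Union>n. A n))"

definition total_variation ::
  "('v \<Rightarrow> real) \<Rightarrow> 'a measure \<Rightarrow> ('a set \<Rightarrow> 'v) \<Rightarrow> 'a set \<Rightarrow> ereal" where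
  "total_variation p M \<mu> A = (SUP mE \<in> {(m :: nat, E :: nat \<Rightarrow> 'a set). (\<forall>i<m. E i \<in> sets M \<and> E i \<subseteq> A)
        \<and> disjoint_family_on E {..<m}}. ereal (\<Sum>i<fst mE. p (\<mu> (snd mE i))))"

definition vm_range :: "'a measure \<Rightarrow> ('a set \<Rightarrow> 'v::real_normed_vector) \<Rightarrow> 'v set" where
  "vm_range M \<mu> = closure (convex hull (\<mu> ` sets M))"

end

theory Submission
  imports Defs "HOL-Probability.Distributions"
begin

text \<open>For a scalar measure \<open>\<xi> \<bullet> \<mu>\<close> the total variation is the width of the range of \<open>\<mu>\<close> in
  direction \<open>\<xi>\<close>, which is monotone in the range. If \<open>p v\<close> is an average of functions
  \<open>\<bar>\<xi> \<bullet> v\<bar>\<close>, then the \<open>p\<close>-variation of \<open>\<mu>\<close> is the same average of widths, since finitely many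
  (hence, by compactness, all) directions can be nearly optimised by one common partition. A
  Euclidean norm is such an average over a Gaussian vector \<open>\<xi>\<close>; in the plane every seminorm is a
  limit of finite sums of this kind. A proper inclusion of ranges makes the width strictly smaller
  in some direction, hence near it, and either the full support of the Gaussian or strict
  convexity ensures that such directions carry weight in the average.\<close>

section \<open>Vector measures and seminorms\<close>

text \<open>The condition on \<open>p\<close> and the dimension serves the representation of
  \<open>p\<close> by functions \<open>\<bar>\<xi> \<bullet> v\<bar>\<close>: from dimension three
  on, a norm need not be an average of such functions (the maximum norm is not). The ambient inner
  product is auxiliary and unrelated to \<open>p\<close>; it turns functionals into vectors.
  Gaussian averages are convenient because linear combinations of independent normal variables are
  again normal, so the average reduces to one one-dimensional moment. In the plane no limiting
  representing measure is constructed; \<open>p\<close> is only approximated. Since strict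
  inequalities are lost in a limit, strictness there needs a gap \<open>c > 0\<close> common to all
  sufficiently good approximations.\<close>

lemma vector_measure_empty:
  assumes "vector_measure M \<mu>"
  shows "\<mu> {} = 0"
proof -
  have "(\<lambda>n::nat. \<mu> {}) sums \<mu> (\<Union>n::nat. {})"
    using assms unfolding vector_measure_def by (auto simp: disjoint_family_on_def)
  then show ?thesis
    using summable_const_iff sums_summable by blast
qed

lemma vector_measure_Un:
  assumes "vector_measure M \<mu>" "A \<in> sets M" "B \<in> sets M" "A \<inter> B = {}"
  shows "\<mu> (A \<union> B) = \<mu> A + \<mu> B"
proof -
  have "range (binaryset A B) \<subseteq> sets M" "disjoint_family (binaryset A B)"
    using assms by (auto simp: range_binaryset_eq disjoint_family_on_def binaryset_def)
  then have "(\<lambda>n. \<mu> (binaryset A B n)) sums \<mu> (A \<union> B)"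
    using assms(1) unfolding vector_measure_def UN_binaryset_eq[symmetric] by blast
  moreover have "(\<lambda>n. \<mu> (binaryset A B n)) sums (\<mu> A + \<mu> B)"
    using vector_measure_empty[OF assms(1)] by (rule binaryset_sums)
  ultimately show ?thesis
    using sums_unique2 by blast
qed

lemma vector_measure_Diff:
  assumes "vector_measure M \<mu>" "A \<in> sets M" "B \<in> sets M" "B \<subseteq> A"
  shows "\<mu> (A - B) = \<mu> A - \<mu> B"
  using vector_measure_Un[OF assms(1), of "A - B" B] assms
  by (simp add: Un_absorb2 Diff_disjoint Int_commute algebra_simps)

lemma vector_measure_UN:
  assumes "vector_measure M \<mu>" "finite I" "\<And>i. i \<in> I \<Longrightarrow> E i \<in> sets M" "disjoint_family_on E I"
  shows "\<mu> (\<Union>i\<in>I. E i) = (\<Sum>i\<in>I. \<mu> (E i))"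
  using assms(2-4)
proof (induction I)
  case empty
  then show ?case using vector_measure_empty[OF assms(1)] by simp
next
  case (insert x F)
  have "\<mu> (E x \<union> (\<Union>i\<in>F. E i)) = \<mu> (E x) + \<mu> (\<Union>i\<in>F. E i)"
  proof (rule vector_measure_Un[OF assms(1)])
    show "E x \<inter> \<Union> (E ` F) = {}"
      using insert by (auto simp: disjoint_family_on_def)
  qed (use insert in auto)
  with insert show ?case
    by (simp add: disjoint_family_on_def)
qed

text \<open>If the range were unbounded, one could repeatedly split off from a set with unbounded
  subrange a piece of measure at least \<open>1\<close>; these pieces are disjoint, so their measures would
  have to be summable.\<close>

lemma vector_measure_bounded:
  fixes \<mu> :: "'a set \<Rightarrow> 'v::real_normed_vector"
  assumes "vector_measure M \<mu>"
  shows "bounded (\<mu> ` sets M)"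
proof (rule ccontr)
  define U where "U A \<longleftrightarrow> A \<in> sets M \<and> \<not> bounded (\<mu> ` {E \<in> sets M. E \<subseteq> A})" for A
  assume unb: "\<not> bounded (\<mu> ` sets M)"
  have "{E \<in> sets M. E \<subseteq> space M} = sets M"
    using sets.sets_into_space by blast
  with unb have U0: "U (space M)" by (simp add: U_def)
  have step: "\<exists>B. U B \<and> B \<subseteq> A \<and> norm (\<mu> (A - B)) \<ge> 1" if A: "U A" for A
  proof -
    have AM: "A \<in> sets M" using A by (simp add: U_def)
    \<comment> \<open>The margin \<open>norm (\<mu> A) + 1\<close> makes both \<open>E\<close> and
      \<open>A - E\<close> have measure of norm at least 1, so the discarded half is large whichever
      half keeps an unbounded subrange.\<close>
    obtain E where E: "E \<in> sets M" "E \<subseteq> A" "norm (\<mu> E) > norm (\<mu> A) + 1"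
      using A by (force simp: U_def bounded_iff not_le)
    have d: "\<mu> (A - E) = \<mu> A - \<mu> E"
      using vector_measure_Diff[OF assms AM E(1,2)] .
    have big: "norm (\<mu> (A - E)) \<ge> 1"
      unfolding d using E(3) norm_triangle_ineq2[of "\<mu> E" "\<mu> A"] by (simp add: norm_minus_commute)
    have "U E \<or> U (A - E)"
    proof (rule ccontr)
      assume "\<not> ?thesis"
      then have "bounded (\<mu> ` {F \<in> sets M. F \<subseteq> E})" "bounded (\<mu> ` {F \<in> sets M. F \<subseteq> A - E})"
        using E AM by (auto simp: U_def)
      then obtain a b where a: "\<And>F. F \<in> sets M \<Longrightarrow> F \<subseteq> E \<Longrightarrow> norm (\<mu> F) \<le> a"
        and b: "\<And>F. F \<in> sets M \<Longrightarrow> F \<subseteq> A - E \<Longrightarrow> norm (\<mu> F) \<le> b"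
        unfolding bounded_iff by blast
      have "norm (\<mu> F) \<le> a + b" if F: "F \<in> sets M" "F \<subseteq> A" for F
      proof -
        have "\<mu> ((F \<inter> E) \<union> (F - E)) = \<mu> (F \<inter> E) + \<mu> (F - E)"
          using F E by (intro vector_measure_Un[OF assms]) auto
        moreover have "(F \<inter> E) \<union> (F - E) = F" by auto
        moreover have "norm (\<mu> (F \<inter> E)) \<le> a" "norm (\<mu> (F - E)) \<le> b"
          using F E AM by (auto intro!: a b)
        ultimately show ?thesis
          using norm_triangle_ineq[of "\<mu> (F \<inter> E)" "\<mu> (F - E)"] by simp
      qed
      then have "bounded (\<mu> ` {E \<in> sets M. E \<subseteq> A})"
        unfolding bounded_iff by blast
      with A show False by (simp add: U_def)
    qed
    then show ?thesis
    proof
      assume "U E"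
      with E big show ?thesis by blast
    next
      assume "U (A - E)"
      moreover have "A - (A - E) = E" using E by auto
      moreover have "norm (\<mu> E) \<ge> 1" using E norm_ge_zero[of "\<mu> A"] by linarith
      ultimately show ?thesis by (intro exI[of _ "A - E"]) auto
    qed
  qed
  from step obtain g where g: "\<And>A. U A \<Longrightarrow> U (g A) \<and> g A \<subseteq> A \<and> norm (\<mu> (A - g A)) \<ge> 1"
    by metis
  define D where "D n = (g ^^ n) (space M)" for n
  have D: "U (D n)" for n
    by (induction n) (use U0 g in \<open>auto simp: D_def\<close>)
  have DS: "D (Suc n) \<subseteq> D n \<and> norm (\<mu> (D n - D (Suc n))) \<ge> 1" for n
    using g[OF D[of n]] by (simp add: D_def)
  have anti: "D n \<subseteq> D m" if "m \<le> n" for m n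
    using lift_Suc_antimono_le[of D, OF _ that] DS by blast
  have "disjoint_family (\<lambda>n. D n - D (Suc n))"
    unfolding disjoint_family_on_def
  proof (intro ballI impI)
    fix m n :: nat assume "m \<noteq> n"
    then have "Suc m \<le> n \<or> Suc n \<le> m" by auto
    then show "(D m - D (Suc m)) \<inter> (D n - D (Suc n)) = {}"
      using anti by blast
  qed
  moreover have "range (\<lambda>n. D n - D (Suc n)) \<subseteq> sets M"
    using D by (auto simp: U_def)
  ultimately have "(\<lambda>n. \<mu> (D n - D (Suc n))) sums \<mu> (\<Union>n. D n - D (Suc n))"
    using assms unfolding vector_measure_def by auto
  then have "(\<lambda>n. \<mu> (D n - D (Suc n))) \<longlonglongrightarrow> 0"
    using summable_LIMSEQ_zero sums_summable by blast
  then have "eventually (\<lambda>n. norm (\<mu> (D n - D (Suc n))) < 1) sequentially"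
    using order_tendstoD(2) tendsto_norm_zero zero_less_one by blast
  then obtain n where "norm (\<mu> (D n - D (Suc n))) < 1"
    by (auto simp: eventually_sequentially)
  with DS[of n] show False by simp
qed

section \<open>Elementary facts on seminorms and total variation\<close>

lemma is_seminorm_0: "is_seminorm p \<Longrightarrow> p 0 = 0"
  unfolding is_seminorm_def by (metis abs_zero mult_zero_left scaleR_zero_left)

lemma is_seminorm_minus: "is_seminorm p \<Longrightarrow> p (- x) = p x"
  unfolding is_seminorm_def by (metis abs_minus_cancel abs_one mult_1 scaleR_minus1_left)

lemma is_seminorm_triangle: "is_seminorm p \<Longrightarrow> p (x + y) \<le> p x + p y"
  unfolding is_seminorm_def by blast

lemma is_seminorm_scaleR: "is_seminorm p \<Longrightarrow> p (c *\<^sub>R x) = \<bar>c\<bar> * p x"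
  unfolding is_seminorm_def by blast

lemma is_seminorm_nonneg:
  assumes "is_seminorm p"
  shows "0 \<le> p x"
  using is_seminorm_triangle[OF assms, of x "- x"] is_seminorm_minus[OF assms, of x]
    is_seminorm_0[OF assms] by simp

lemma is_seminorm_diff: "is_seminorm p \<Longrightarrow> \<bar>p x - p y\<bar> \<le> p (x - y)"
  using is_seminorm_triangle[of p "x - y" y] is_seminorm_triangle[of p "y - x" x]
    is_seminorm_minus[of p "x - y"] by auto

lemma is_seminorm_sum:
  assumes "is_seminorm p"
  shows "p (\<Sum>i\<in>I. f i) \<le> (\<Sum>i\<in>I. p (f i))"
proof (induction I rule: infinite_finite_induct)
  case (insert x F)
  then show ?case using is_seminorm_triangle[OF assms, of "f x" "sum f F"] by simp
qed (auto simp: is_seminorm_0[OF assms])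

lemma is_seminorm_le_norm:
  fixes p :: "'v::euclidean_space \<Rightarrow> real"
  assumes "is_seminorm p"
  shows "p x \<le> (\<Sum>b\<in>Basis. p b) * norm x"
proof -
  have "p (\<Sum>b\<in>Basis. (x \<bullet> b) *\<^sub>R b) \<le> (\<Sum>b\<in>Basis. \<bar>x \<bullet> b\<bar> * p b)"
    using is_seminorm_sum[OF assms] is_seminorm_scaleR[OF assms] by (metis (no_types, lifting) sum.cong)
  also have "\<dots> \<le> (\<Sum>b\<in>Basis. norm x * p b)"
    by (intro sum_mono mult_right_mono is_seminorm_nonneg[OF assms]) (simp add: Basis_le_norm)
  finally show ?thesis by (simp add: euclidean_representation sum_distrib_left mult.commute)
qed

lemma continuous_on_seminorm:
  fixes p :: "'v::euclidean_space \<Rightarrow> real"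
  assumes "is_seminorm p"
  shows "continuous_on UNIV p"
proof (rule lipschitz_on_continuous_on)
  show "(\<Sum>b\<in>Basis. p b)-lipschitz_on UNIV p"
  proof (rule lipschitz_onI)
    show "dist (p x) (p y) \<le> (\<Sum>b\<in>Basis. p b) * dist x y" for x y
      using is_seminorm_diff[OF assms, of x y] is_seminorm_le_norm[OF assms, of "x - y"]
      by (simp add: dist_norm)
    show "0 \<le> (\<Sum>b\<in>Basis. p b)" by (intro sum_nonneg is_seminorm_nonneg[OF assms])
  qed
qed

lemma is_seminorm_sum_abs_inner: "is_seminorm (\<lambda>v. \<Sum>j\<in>J. \<bar>\<xi> j \<bullet> v\<bar>)"
  unfolding is_seminorm_def
proof (intro conjI allI)
  show "(\<Sum>j\<in>J. \<bar>\<xi> j \<bullet> (x + y)\<bar>) \<le> (\<Sum>j\<in>J. \<bar>\<xi> j \<bullet> x\<bar>) + (\<Sum>j\<in>J. \<bar>\<xi> j \<bullet> y\<bar>)" for x y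
    unfolding inner_add_right sum.distrib[symmetric] by (intro sum_mono abs_triangle_ineq)
qed (simp add: abs_mult sum_distrib_left)

text \<open>The definition of total variation uses initial segments of the naturals as index sets;
  an arbitrary finite index type is needed later, where atoms are indexed by pairs of sets of
  directions.\<close>

lemma sum_le_total_variation:
  fixes E :: "'i \<Rightarrow> 'a set"
  assumes "finite I" "\<And>i. i \<in> I \<Longrightarrow> E i \<in> sets M" "\<And>i. i \<in> I \<Longrightarrow> E i \<subseteq> A" "disjoint_family_on E I"
  shows "ereal (\<Sum>i\<in>I. p (\<mu> (E i))) \<le> total_variation p M \<mu> A"
proof -
  obtain h where h: "bij_betw h {..<card I} I"
    using ex_bij_betw_nat_finite[OF assms(1)] by (auto simp: atLeast0LessThan)
  have hI: "h i \<in> I" if "i < card I" for i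
    using bij_betwE[OF h] that by auto
  have "disjoint_family_on (E \<circ> h) {..<card I}"
    using assms(4) h hI unfolding disjoint_family_on_def bij_betw_def inj_on_def o_def
    by (metis lessThan_iff)
  then have mem: "(card I, E \<circ> h) \<in> {(m, E). (\<forall>i<m. E i \<in> sets M \<and> E i \<subseteq> A) \<and> disjoint_family_on E {..<m}}"
    using assms(2,3) hI by auto
  have "(\<Sum>i\<in>I. p (\<mu> (E i))) = (\<Sum>i<card I. p (\<mu> ((E \<circ> h) i)))"
    using sum.reindex_bij_betw[OF h, of "\<lambda>i. p (\<mu> (E i))"] by simp
  then show ?thesis
    unfolding total_variation_def
    using SUP_upper[OF mem, of "\<lambda>mE. ereal (\<Sum>i<fst mE. p (\<mu> (snd mE i)))"] by simp
qed

lemma total_variation_leI: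
  assumes "\<And>(m::nat) E. (\<And>i. i < m \<Longrightarrow> E i \<in> sets M) \<Longrightarrow> (\<And>i. i < m \<Longrightarrow> E i \<subseteq> A)
      \<Longrightarrow> disjoint_family_on E {..<m} \<Longrightarrow> ereal (\<Sum>i<m. p (\<mu> (E i))) \<le> c"
  shows "total_variation p M \<mu> A \<le> c"
  unfolding total_variation_def by (rule SUP_least) (use assms in auto)

section \<open>Widths of the range\<close>

text \<open>This is the support function of the difference body of \<open>S\<close>. That body is
  symmetric, which is why the width of a bounded nonempty set is a seminorm in
  \<open>\<xi>\<close>.\<close>

definition width :: "'v::euclidean_space set \<Rightarrow> 'v \<Rightarrow> real" where
  "width S \<xi> = (SUP z\<in>S \<times> S. \<xi> \<bullet> (fst z - snd z))"

lemma width_leI: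
  assumes "S \<noteq> {}" "\<And>x y. x \<in> S \<Longrightarrow> y \<in> S \<Longrightarrow> \<xi> \<bullet> (x - y) \<le> c"
  shows "width S \<xi> \<le> c"
  unfolding width_def by (rule cSUP_least) (use assms in auto)

lemma inner_diff_le_width:
  assumes "bounded S" "x \<in> S" "y \<in> S"
  shows "\<xi> \<bullet> (x - y) \<le> width S \<xi>"
proof -
  obtain b where b: "\<And>x. x \<in> S \<Longrightarrow> norm x \<le> b"
    using assms(1) by (auto simp: bounded_iff)
  have "\<xi> \<bullet> (u - v) \<le> norm \<xi> * (b + b)" if "u \<in> S" "v \<in> S" for u v
  proof -
    have "\<xi> \<bullet> (u - v) \<le> norm \<xi> * norm (u - v)" by (rule norm_cauchy_schwarz)
    also have "norm (u - v) \<le> b + b"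
      using norm_triangle_ineq4[of u v] b[OF that(1)] b[OF that(2)] by linarith
    finally show ?thesis by (simp add: mult_left_mono)
  qed
  then have "bdd_above ((\<lambda>z. \<xi> \<bullet> (fst z - snd z)) ` (S \<times> S))"
    by (intro bdd_aboveI) auto
  from cSUP_upper[OF _ this, of "(x, y)"] assms show ?thesis
    by (simp add: width_def)
qed

lemma width_mono:
  assumes "bounded T" "S \<subseteq> T" "S \<noteq> {}"
  shows "width S \<xi> \<le> width T \<xi>"
  using assms by (intro width_leI inner_diff_le_width) auto

lemma is_seminorm_width:
  assumes S: "bounded S" "S \<noteq> {}"
  shows "is_seminorm (width S)"
  unfolding is_seminorm_def
proof (intro conjI allI)
  show "width S (x + y) \<le> width S x + width S y" for x y
  proof (rule width_leI[OF S(2)])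
    fix u v assume "u \<in> S" "v \<in> S"
    then show "(x + y) \<bullet> (u - v) \<le> width S x + width S y"
      unfolding inner_add_left by (intro add_mono inner_diff_le_width S)
  qed
  have le: "width S (c *\<^sub>R x) \<le> \<bar>c\<bar> * width S x" for c x
  proof (rule width_leI[OF S(2)])
    fix u v assume uv: "u \<in> S" "v \<in> S"
    have "(c *\<^sub>R x) \<bullet> (u - v) \<le> \<bar>c\<bar> * \<bar>x \<bullet> (u - v)\<bar>"
      by (simp flip: abs_mult)
    also have "\<bar>x \<bullet> (u - v)\<bar> \<le> width S x"
      using inner_diff_le_width[OF S(1) uv, of x] inner_diff_le_width[OF S(1) uv(2,1), of x]
      by (simp add: inner_diff_right)
    finally show "(c *\<^sub>R x) \<bullet> (u - v) \<le> \<bar>c\<bar> * width S x"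
      by (simp add: mult_left_mono)
  qed
  show "width S (c *\<^sub>R x) = \<bar>c\<bar> * width S x" for c x
  proof (cases "c = 0")
    case True
    obtain u where "u \<in> S" using S by auto
    then have "0 \<le> width S 0" using inner_diff_le_width[OF S(1), of u u 0] by simp
    with True le[of 0 0] show ?thesis by simp
  next
    case False
    then have "\<bar>c\<bar> * width S x \<le> \<bar>c\<bar> * (\<bar>1 / c\<bar> * width S (c *\<^sub>R x))"
      using le[of "1 / c" "c *\<^sub>R x"] by (intro mult_left_mono) auto
    with False le[of c x] show ?thesis by simp
  qed
qed

text \<open>In a separating direction \<open>z\<close> lies strictly below all of \<open>S\<close>.
  The maximum over \<open>S\<close> is attained at a point of \<open>S\<close>, hence of
  \<open>T\<close>, and its difference to \<open>z\<close> exceeds every difference within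
  \<open>S\<close> by a definite amount.\<close>

lemma width_less:
  assumes "compact S" "convex S" "S \<noteq> {}" "bounded T" "S \<subseteq> T" "z \<in> T" "z \<notin> S"
  obtains \<xi> where "width S \<xi> < width T \<xi>"
proof -
  obtain \<xi> b where \<xi>: "\<xi> \<bullet> z < b" "\<And>x. x \<in> S \<Longrightarrow> \<xi> \<bullet> x > b"
    using separating_hyperplane_closed_point[of S z] assms compact_imp_closed by blast
  obtain y where y: "y \<in> S" "\<And>x. x \<in> S \<Longrightarrow> \<xi> \<bullet> x \<le> \<xi> \<bullet> y"
    using continuous_attains_sup[OF assms(1,3) continuous_on_inner[OF continuous_on_const continuous_on_id], of \<xi>]
    by auto
  have "width S \<xi> \<le> \<xi> \<bullet> y - b"
  proof (rule width_leI[OF assms(3)])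
    fix u v assume "u \<in> S" "v \<in> S"
    then show "\<xi> \<bullet> (u - v) \<le> \<xi> \<bullet> y - b"
      using y(2)[of u] \<xi>(2)[of v] by (simp add: inner_diff_right)
  qed
  also have "\<dots> < \<xi> \<bullet> (y - z)" using \<xi>(1) by (simp add: inner_diff_right)
  also have "\<dots> \<le> width T \<xi>" using assms y by (intro inner_diff_le_width) auto
  finally show ?thesis using that by blast
qed

section \<open>Widths of the range of a vector measure\<close>

lemma measure_in_vm_range: "E \<in> sets M \<Longrightarrow> \<mu> E \<in> vm_range M \<mu>"
  unfolding vm_range_def by (meson closure_subset hull_subset image_eqI subsetD)

lemma vm_range_nonempty: "vm_range M \<mu> \<noteq> {}"
  using measure_in_vm_range[OF sets.empty_sets] by blast

lemma convex_vm_range: "convex (vm_range M \<mu>)"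
  by (simp add: vm_range_def convex_closure convex_convex_hull)

lemma compact_vm_range:
  fixes \<mu> :: "'a set \<Rightarrow> 'v::euclidean_space"
  assumes "vector_measure M \<mu>"
  shows "compact (vm_range M \<mu>)"
  unfolding vm_range_def using vector_measure_bounded[OF assms]
  by (simp add: bounded_convex_hull)

lemmas bounded_vm_range = compact_imp_bounded[OF compact_vm_range]

lemmas is_seminorm_width_vm_range = is_seminorm_width[OF bounded_vm_range vm_range_nonempty]

text \<open>Half-spaces are closed and convex, so the bound passes from values of
  \<open>\<mu>\<close> to the closed convex hull, one argument of the difference at a time.\<close>

lemma width_vm_range_leI:
  fixes \<mu> :: "'a set \<Rightarrow> 'v::euclidean_space"
  assumes "\<And>E F. E \<in> sets M \<Longrightarrow> F \<in> sets M \<Longrightarrow> \<xi> \<bullet> (\<mu> E - \<mu> F) \<le> c"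
  shows "width (vm_range M \<mu>) \<xi> \<le> c"
proof -
  have 1: "\<xi> \<bullet> x \<le> c + \<xi> \<bullet> \<mu> F" if "x \<in> vm_range M \<mu>" "F \<in> sets M" for x F
  proof -
    have "vm_range M \<mu> \<subseteq> {x. \<xi> \<bullet> x \<le> c + \<xi> \<bullet> \<mu> F}"
      unfolding vm_range_def
      by (intro closure_minimal hull_minimal closed_halfspace_le convex_halfspace_le)
        (use assms[OF _ that(2)] in \<open>auto simp: inner_diff_right algebra_simps\<close>)
    with that show ?thesis by auto
  qed
  have 2: "\<xi> \<bullet> x - c \<le> \<xi> \<bullet> y" if "x \<in> vm_range M \<mu>" "y \<in> vm_range M \<mu>" for x y
  proof -
    have "vm_range M \<mu> \<subseteq> {y. \<xi> \<bullet> y \<ge> \<xi> \<bullet> x - c}"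
      unfolding vm_range_def
      by (intro closure_minimal hull_minimal closed_halfspace_ge convex_halfspace_ge)
        (use 1[OF that(1)] in \<open>auto simp: algebra_simps\<close>)
    with that show ?thesis by auto
  qed
  show ?thesis
  proof (rule width_leI[OF vm_range_nonempty])
    fix x y assume "x \<in> vm_range M \<mu>" "y \<in> vm_range M \<mu>"
    from 2[OF this] show "\<xi> \<bullet> (x - y) \<le> c" by (simp add: inner_diff_right)
  qed
qed

text \<open>A finite Hahn decomposition: the pieces with nonnegative
  \<open>\<xi> \<bullet> \<mu> (E i)\<close> are united into one set and the others into a second
  one, and the sum is \<open>\<xi>\<close> applied to the difference of the two measures.\<close>

lemma sum_abs_inner_le_width:
  fixes \<mu> :: "'a set \<Rightarrow> 'v::euclidean_space"
  assumes "vector_measure M \<mu>" "finite I" "\<And>i. i \<in> I \<Longrightarrow> E i \<in> sets M" "disjoint_family_on E I"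
  shows "(\<Sum>i\<in>I. \<bar>\<xi> \<bullet> \<mu> (E i)\<bar>) \<le> width (vm_range M \<mu>) \<xi>"
proof -
  define P where "P = {i \<in> I. \<xi> \<bullet> \<mu> (E i) \<ge> 0}"
  have PI: "P \<subseteq> I" "finite P" using assms(2) by (auto simp: P_def)
  have U: "\<mu> (\<Union>i\<in>J. E i) = (\<Sum>i\<in>J. \<mu> (E i))" "(\<Union>i\<in>J. E i) \<in> sets M" if "J \<subseteq> I" for J
  proof -
    have J: "finite J" "\<And>i. i \<in> J \<Longrightarrow> E i \<in> sets M" "disjoint_family_on E J"
      using that assms finite_subset disjoint_family_on_mono by blast+
    show "\<mu> (\<Union>i\<in>J. E i) = (\<Sum>i\<in>J. \<mu> (E i))" by (rule vector_measure_UN[OF assms(1) J])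
    show "(\<Union>i\<in>J. E i) \<in> sets M" using J by blast
  qed
  have "(\<Sum>i\<in>I. \<bar>\<xi> \<bullet> \<mu> (E i)\<bar>) = (\<Sum>i\<in>P. \<bar>\<xi> \<bullet> \<mu> (E i)\<bar>) + (\<Sum>i\<in>I - P. \<bar>\<xi> \<bullet> \<mu> (E i)\<bar>)"
    using sum.subset_diff[OF PI(1) assms(2), of "\<lambda>i. \<bar>\<xi> \<bullet> \<mu> (E i)\<bar>"] by linarith
  also have "\<dots> = (\<Sum>i\<in>P. \<xi> \<bullet> \<mu> (E i)) + (\<Sum>i\<in>I - P. - (\<xi> \<bullet> \<mu> (E i)))"
    by (intro arg_cong2[where f = "(+)"] sum.cong) (auto simp: P_def)
  also have "\<dots> = \<xi> \<bullet> (\<mu> (\<Union>i\<in>P. E i) - \<mu> (\<Union>i\<in>I - P. E i))"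
    using PI by (simp add: U inner_diff_right inner_sum_right sum_negf)
  also have "\<dots> \<le> width (vm_range M \<mu>) \<xi>"
    using PI by (intro inner_diff_le_width bounded_vm_range[OF assms(1)] measure_in_vm_range U) auto
  finally show ?thesis .
qed

text \<open>The bound does not depend on the partition; it absorbs the error terms
  \<open>e * norm v\<close> that arise when one seminorm is replaced by another.\<close>

lemma sum_norm_le_width:
  fixes \<mu> :: "'a set \<Rightarrow> 'v::euclidean_space"
  assumes "vector_measure M \<mu>" "finite I" "\<And>i. i \<in> I \<Longrightarrow> E i \<in> sets M" "disjoint_family_on E I"
  shows "(\<Sum>i\<in>I. norm (\<mu> (E i))) \<le> (\<Sum>b\<in>Basis. width (vm_range M \<mu>) b)"
proof -
  have "(\<Sum>i\<in>I. norm (\<mu> (E i))) \<le> (\<Sum>i\<in>I. \<Sum>b\<in>Basis. \<bar>\<mu> (E i) \<bullet> b\<bar>)"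
    by (intro sum_mono norm_le_l1)
  also have "\<dots> = (\<Sum>b\<in>Basis. \<Sum>i\<in>I. \<bar>b \<bullet> \<mu> (E i)\<bar>)"
    by (subst sum.swap) (simp add: inner_commute)
  also have "\<dots> \<le> (\<Sum>b\<in>Basis. width (vm_range M \<mu>) b)"
    by (intro sum_mono sum_abs_inner_le_width assms)
  finally show ?thesis .
qed

text \<open>The partition consists of the atoms generated by near-optimal sets for the finitely many
  directions in a fine net of the unit sphere.\<close>

lemma width_approx_partition:
  fixes \<mu> :: "'a set \<Rightarrow> 'v::euclidean_space"
  assumes \<mu>: "vector_measure M \<mu>" and "e > 0"
  obtains I :: "('v set \<times> 'v set) set" and A
  where "finite I" "\<And>i. i \<in> I \<Longrightarrow> A i \<in> sets M" "disjoint_family_on A I"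
    "\<And>\<xi>. width (vm_range M \<mu>) \<xi> - e * norm \<xi> \<le> (\<Sum>i\<in>I. \<bar>\<xi> \<bullet> \<mu> (A i)\<bar>)"
proof -
  define w where "w = width (vm_range M \<mu>)"
  have w: "is_seminorm w"
    unfolding w_def by (rule is_seminorm_width_vm_range[OF \<mu>])
  define K where "K = (\<Sum>b\<in>Basis. w b)"
  have K0: "K \<ge> 0" unfolding K_def by (intro sum_nonneg is_seminorm_nonneg[OF w])
  \<comment> \<open>Moving to a net point within \<open>d\<close> changes \<open>w\<close> and the
    sum \<open>g\<close> by at most \<open>K * d\<close> each; together this costs at most
    \<open>e / 2\<close>, and near-optimality at the net point costs the other \<open>e / 2\<close>.
    The summand 1 keeps the denominator positive.\<close>
  define d where "d = e / (4 * (K + 1))"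
  have d0: "d > 0" using \<open>e > 0\<close> K0 by (simp add: d_def)
  have Kd: "2 * (K * d) \<le> e / 2"
  proof -
    have "4 * (K + 1) * d = e" using K0 by (simp add: d_def)
    with d0 show ?thesis by (simp add: algebra_simps)
  qed
  obtain N where N: "finite N" "N \<subseteq> sphere 0 1" "sphere (0::'v) 1 \<subseteq> (\<Union>x\<in>N. ball x d)"
    using compactE_image[OF compact_sphere, of "sphere (0::'v) 1" "\<lambda>x. ball x d"] d0
    by (metis (no_types, lifting) UN_I centre_in_ball open_ball subsetI)
  have "\<exists>E F. E \<in> sets M \<and> F \<in> sets M \<and> \<xi> \<bullet> (\<mu> E - \<mu> F) > w \<xi> - e / 2" for \<xi>
    using width_vm_range_leI[of M \<xi> \<mu> "w \<xi> - e / 2"] \<open>e > 0\<close> unfolding w_def by (force simp: not_less)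
  then obtain E F where E: "\<And>\<xi>. E \<xi> \<in> sets M" and F: "\<And>\<xi>. F \<xi> \<in> sets M"
    and EF: "\<And>\<xi>. \<xi> \<bullet> (\<mu> (E \<xi>) - \<mu> (F \<xi>)) > w \<xi> - e / 2"
    by metis
  \<comment> \<open>\<open>c x\<close> records which of the chosen sets contain \<open>x\<close>;
    its fibres \<open>A i\<close> are the atoms.\<close>
  define c where "c x = ({\<xi> \<in> N. x \<in> E \<xi>}, {\<xi> \<in> N. x \<in> F \<xi>})" for x
  define A where "A i = {x \<in> space M. c x = i}" for i
  define I where "I = Pow N \<times> Pow N"
  have fI: "finite I" using N by (simp add: I_def)
  have AM: "A i \<in> sets M" for i
  proof (cases "i \<in> I")
    case True
    then have "A i = {x \<in> space M. \<forall>\<xi>\<in>N. (x \<in> E \<xi> \<longleftrightarrow> \<xi> \<in> fst i) \<and> (x \<in> F \<xi> \<longleftrightarrow> \<xi> \<in> snd i)}"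
      by (auto simp: A_def c_def I_def)
    also have "\<dots> \<in> sets M"
      using E F N(1) by measurable
    finally show ?thesis .
  next
    case False
    then have "A i = {}" by (auto simp: A_def c_def I_def)
    then show ?thesis by simp
  qed
  have dA: "disjoint_family_on A J" for J
    by (auto simp: disjoint_family_on_def A_def)
  have mE: "\<mu> (E \<xi>) = (\<Sum>i\<in>{i \<in> I. \<xi> \<in> fst i}. \<mu> (A i))" if "\<xi> \<in> N" for \<xi>
  proof -
    have "E \<xi> = (\<Union>i\<in>{i \<in> I. \<xi> \<in> fst i}. A i)"
      using that subsetD[OF sets.sets_into_space[OF E]] by (auto simp: A_def c_def I_def)
    then show ?thesis
      by (simp only:) (rule vector_measure_UN[OF \<mu> _ AM dA], use fI in simp)
  qed
  have mF: "\<mu> (F \<xi>) = (\<Sum>i\<in>{i \<in> I. \<xi> \<in> snd i}. \<mu> (A i))" if "\<xi> \<in> N" for \<xi>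
  proof -
    have "F \<xi> = (\<Union>i\<in>{i \<in> I. \<xi> \<in> snd i}. A i)"
      using that subsetD[OF sets.sets_into_space[OF F]] by (auto simp: A_def c_def I_def)
    then show ?thesis
      by (simp only:) (rule vector_measure_UN[OF \<mu> _ AM dA], use fI in simp)
  qed
  define g where "g \<xi> = (\<Sum>i\<in>I. \<bar>\<xi> \<bullet> \<mu> (A i)\<bar>)" for \<xi>
  have g: "is_seminorm g"
    unfolding g_def using is_seminorm_sum_abs_inner[of "\<lambda>i. \<mu> (A i)" I] by (simp add: inner_commute)
  \<comment> \<open>Besides bounding \<open>g\<close>, this transfers the Lipschitz constant of
    \<open>w\<close> to \<open>g\<close>.\<close>
  have gw: "g \<xi> \<le> w \<xi>" for \<xi>
    unfolding g_def w_def by (rule sum_abs_inner_le_width[OF \<mu> fI AM dA])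
  have net: "w \<eta> - e / 2 \<le> g \<eta>" if "\<eta> \<in> N" for \<eta>
  proof -
    have "\<eta> \<bullet> (\<mu> (E \<eta>) - \<mu> (F \<eta>))
        = (\<Sum>i\<in>{i \<in> I. \<eta> \<in> fst i}. \<eta> \<bullet> \<mu> (A i)) - (\<Sum>i\<in>{i \<in> I. \<eta> \<in> snd i}. \<eta> \<bullet> \<mu> (A i))"
      by (simp only: mE[OF that] mF[OF that] inner_diff_right inner_sum_right)
    also have "\<dots>
        = (\<Sum>i\<in>I. (if \<eta> \<in> fst i then \<eta> \<bullet> \<mu> (A i) else 0) - (if \<eta> \<in> snd i then \<eta> \<bullet> \<mu> (A i) else 0))"
      by (simp only: sum.inter_filter[OF fI] sum_subtractf)
    \<comment> \<open>Each atom enters with coefficient -1, 0 or 1.\<close>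
    also have "\<dots> \<le> g \<eta>" unfolding g_def by (intro sum_mono) auto
    finally show ?thesis using EF[of \<eta>] by linarith
  qed
  have unit: "w \<xi> - e \<le> g \<xi>" if \<xi>1: "norm \<xi> = 1" for \<xi>
  proof -
    obtain \<eta> where \<eta>: "\<eta> \<in> N" "norm (\<xi> - \<eta>) < d"
      using subsetD[OF N(3), of \<xi>] \<xi>1 by (auto simp: dist_norm norm_minus_commute)
    have "w (\<xi> - \<eta>) \<le> K * d"
      using is_seminorm_le_norm[OF w, of "\<xi> - \<eta>"] \<eta>(2) K0 mult_left_mono[of "norm (\<xi> - \<eta>)" d K]
      by (simp add: K_def)
    moreover have "\<bar>w \<xi> - w \<eta>\<bar> \<le> w (\<xi> - \<eta>)" "\<bar>g \<xi> - g \<eta>\<bar> \<le> g (\<xi> - \<eta>)" "g (\<xi> - \<eta>) \<le> w (\<xi> - \<eta>)"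
      by (rule is_seminorm_diff[OF w] is_seminorm_diff[OF g] gw)+
    ultimately show ?thesis using net[OF \<eta>(1)] Kd by linarith
  qed
  have fin: "w \<xi> - e * norm \<xi> \<le> g \<xi>" for \<xi>
  proof (cases "\<xi> = 0")
    case True
    then show ?thesis by (simp add: is_seminorm_0[OF w] is_seminorm_0[OF g])
  next
    case False
    define u where "u = (1 / norm \<xi>) *\<^sub>R \<xi>"
    have u: "norm u = 1" "norm \<xi> *\<^sub>R u = \<xi>" using False by (auto simp: u_def)
    have "norm \<xi> * (w u - e) \<le> norm \<xi> * g u" using unit[OF u(1)] by (intro mult_left_mono) auto
    moreover have "w \<xi> = norm \<xi> * w u" "g \<xi> = norm \<xi> * g u"
      using is_seminorm_scaleR[OF w, of "norm \<xi>" u] is_seminorm_scaleR[OF g, of "norm \<xi>" u] u(2) by auto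
    ultimately show ?thesis by (simp add: algebra_simps)
  qed
  show ?thesis
    by (rule that[OF fI AM dA fin[unfolded g_def w_def]])
qed

text \<open>Uniform approximation of \<open>p\<close> by \<open>q\<close> on the unit sphere thus
  becomes approximation of total variations. Taking \<open>q\<close> to be zero gives
  finiteness.\<close>

lemma total_variation_mono:
  fixes \<mu> :: "'a set \<Rightarrow> 'v::euclidean_space"
  assumes \<mu>: "vector_measure M \<mu>" and le: "\<And>v. p v \<le> q v + e * norm v" and "e \<ge> 0"
  shows "total_variation p M \<mu> (space M) \<le> total_variation q M \<mu> (space M)
    + ereal (e * (\<Sum>b\<in>Basis. width (vm_range M \<mu>) b))"
proof (rule total_variation_leI)
  fix m :: nat and E
  assume E: "\<And>i. i < m \<Longrightarrow> E i \<in> sets M" "\<And>i. i < m \<Longrightarrow> E i \<subseteq> space M" "disjoint_family_on E {..<m}"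
  have "(\<Sum>i<m. p (\<mu> (E i))) \<le> (\<Sum>i<m. q (\<mu> (E i))) + e * (\<Sum>i<m. norm (\<mu> (E i)))"
    unfolding sum_distrib_left sum.distrib[symmetric] by (intro sum_mono le)
  moreover have "e * (\<Sum>i<m. norm (\<mu> (E i))) \<le> e * (\<Sum>b\<in>Basis. width (vm_range M \<mu>) b)"
    using E \<open>e \<ge> 0\<close> by (intro mult_left_mono sum_norm_le_width[OF \<mu>]) auto
  ultimately have "ereal (\<Sum>i<m. p (\<mu> (E i)))
      \<le> ereal (\<Sum>i<m. q (\<mu> (E i))) + ereal (e * (\<Sum>b\<in>Basis. width (vm_range M \<mu>) b))"
    by simp
  also have "\<dots> \<le> total_variation q M \<mu> (space M) + ereal (e * (\<Sum>b\<in>Basis. width (vm_range M \<mu>) b))"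
    using E by (intro add_right_mono sum_le_total_variation) auto
  finally show "ereal (\<Sum>i<m. p (\<mu> (E i))) \<le> \<dots>" .
qed

text \<open>The upper bound holds partition by partition. For the lower bound a single partition
  serves all \<open>\<omega>\<close> with error \<open>e * norm (f \<omega>)\<close>, which is
  integrable, so no supremum has to be exchanged with the integral. \<open>N\<close> will be a
  Gaussian or a finite counting measure.\<close>

lemma total_variation_eq_integral_width:
  fixes \<mu> :: "'a set \<Rightarrow> 'v::euclidean_space"
  assumes \<mu>: "vector_measure M \<mu>" and f: "integrable N f"
    and p: "\<And>v. p v = (\<integral>\<omega>. \<bar>f \<omega> \<bullet> v\<bar> \<partial>N)"
  shows "integrable N (\<lambda>\<omega>. width (vm_range M \<mu>) (f \<omega>))" (is ?int)
    and "total_variation p M \<mu> (space M) = ereal (\<integral>\<omega>. width (vm_range M \<mu>) (f \<omega>) \<partial>N)" (is ?eq)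
proof -
  define w where "w = width (vm_range M \<mu>)"
  have w: "is_seminorm w"
    unfolding w_def by (rule is_seminorm_width_vm_range[OF \<mu>])
  define K where "K = (\<Sum>b\<in>Basis. w b)"
  have wK: "w x \<le> K * norm x" for x
    unfolding K_def by (rule is_seminorm_le_norm[OF w])
  have "w \<in> borel_measurable borel"
    by (intro borel_measurable_continuous_onI continuous_on_seminorm w)
  then have [measurable]: "(\<lambda>\<omega>. w (f \<omega>)) \<in> borel_measurable N"
    using f by measurable
  have wi: "integrable N (\<lambda>\<omega>. w (f \<omega>))"
  proof (rule Bochner_Integration.integrable_bound)
    show "integrable N (\<lambda>\<omega>. K * norm (f \<omega>))" using f by simp
    show "AE \<omega> in N. norm (w (f \<omega>)) \<le> norm (K * norm (f \<omega>))"
      using wK is_seminorm_nonneg[OF w] by (intro AE_I2) (smt (verit) real_norm_def)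
  qed measurable
  then show ?int by (simp add: w_def)
  have fi: "integrable N (\<lambda>\<omega>. \<bar>f \<omega> \<bullet> v\<bar>)" for v using f by simp
  have sum_p: "(\<Sum>i\<in>I. p (u i)) = (\<integral>\<omega>. (\<Sum>i\<in>I. \<bar>f \<omega> \<bullet> u i\<bar>) \<partial>N)" for I :: "'i set" and u
    unfolding p by (rule Bochner_Integration.integral_sum[symmetric]) (rule fi)
  show ?eq
  proof (rule antisym)
    show le: "total_variation p M \<mu> (space M) \<le> ereal (\<integral>\<omega>. width (vm_range M \<mu>) (f \<omega>) \<partial>N)"
    proof (rule total_variation_leI)
      fix m :: nat and E
      assume E: "\<And>i. i < m \<Longrightarrow> E i \<in> sets M" "\<And>i. i < m \<Longrightarrow> E i \<subseteq> space M" "disjoint_family_on E {..<m}"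
      have "(\<Sum>i<m. p (\<mu> (E i))) \<le> (\<integral>\<omega>. w (f \<omega>) \<partial>N)"
        unfolding sum_p using E
        by (intro integral_mono Bochner_Integration.integrable_sum fi wi)
          (auto simp: w_def intro!: sum_abs_inner_le_width[OF \<mu>])
      then show "ereal (\<Sum>i<m. p (\<mu> (E i))) \<le> ereal (\<integral>\<omega>. width (vm_range M \<mu>) (f \<omega>) \<partial>N)"
        by (simp add: w_def)
    qed
    define C where "C = (\<integral>\<omega>. norm (f \<omega>) \<partial>N)"
    have C0: "C \<ge> 0" unfolding C_def by simp
    have approx: "ereal ((\<integral>\<omega>. w (f \<omega>) \<partial>N) - e * C) \<le> total_variation p M \<mu> (space M)" if "e > 0" for e
    proof -
      obtain I :: "('v set \<times> 'v set) set" and A where IA: "finite I" "\<And>i. i \<in> I \<Longrightarrow> A i \<in> sets M" "disjoint_family_on A I"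
        and wA: "\<And>\<xi>. w \<xi> - e * norm \<xi> \<le> (\<Sum>i\<in>I. \<bar>\<xi> \<bullet> \<mu> (A i)\<bar>)"
        using width_approx_partition[OF \<mu> \<open>e > 0\<close>] unfolding w_def by blast
      have "(\<integral>\<omega>. w (f \<omega>) \<partial>N) - e * C = (\<integral>\<omega>. w (f \<omega>) - e * norm (f \<omega>) \<partial>N)"
        using f wi by (simp add: C_def)
      also have "\<dots> \<le> (\<Sum>i\<in>I. p (\<mu> (A i)))"
        unfolding sum_p
      proof (rule integral_mono)
        show "integrable N (\<lambda>\<omega>. w (f \<omega>) - e * norm (f \<omega>))"
          using f wi by simp
      qed (rule Bochner_Integration.integrable_sum fi wA)+
      finally have "ereal ((\<integral>\<omega>. w (f \<omega>) \<partial>N) - e * C) \<le> ereal (\<Sum>i\<in>I. p (\<mu> (A i)))" by simp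
      also have "\<dots> \<le> total_variation p M \<mu> (space M)"
        by (rule sum_le_total_variation[OF IA(1,2) sets.sets_into_space[OF IA(2)] IA(3)])
      finally show ?thesis .
    qed
    obtain T where T: "total_variation p M \<mu> (space M) = ereal T"
      using le approx[of 1] by (cases "total_variation p M \<mu> (space M)") auto
    have "(\<integral>\<omega>. w (f \<omega>) \<partial>N) \<le> T"
    proof (rule field_le_epsilon)
      fix e :: real assume "e > 0"
      then have "(\<integral>\<omega>. w (f \<omega>) \<partial>N) - e / (C + 1) * C \<le> T"
        using approx[of "e / (C + 1)"] C0 T by simp
      moreover have "e / (C + 1) * C \<le> e" using C0 \<open>e > 0\<close> by (simp add: field_simps)
      ultimately show "(\<integral>\<omega>. w (f \<omega>) \<partial>N) \<le> T + e" by linarith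
    qed
    then show "ereal (\<integral>\<omega>. width (vm_range M \<mu>) (f \<omega>) \<partial>N) \<le> total_variation p M \<mu> (space M)"
      by (simp add: T w_def)
  qed
qed

section \<open>Euclidean norms as Gaussian averages\<close>

text \<open>Subtracting the square of \<open>B u \<cdot> / \<surd>(B u u)\<close> keeps the form positive semidefinite by the
  Cauchy-Schwarz inequality and adds \<open>u\<close> to its kernel.\<close>

lemma psd_form_eq_sum_squares:
  fixes B :: "'v::euclidean_space \<Rightarrow> 'v \<Rightarrow> real"
  assumes "bilinear B" "\<And>x y. B x y = B y x" "\<And>x. 0 \<le> B x x"
  shows "\<exists>k::nat. \<exists>\<xi>. \<forall>v. B v v = (\<Sum>j<k. (\<xi> j \<bullet> v)\<^sup>2)"
  using assms
\<comment> \<open>The codimension of the kernel of the form decreases.\<close>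
proof (induction "DIM('v) - dim {v. \<forall>w. B v w = 0}" arbitrary: B rule: less_induct)
  case less
  show ?case
  proof (cases "\<forall>v. B v v = 0")
    case True
    then show ?thesis by (intro exI[of _ 0]) simp
  next
    case False
    note bil = bilinear_ladd[OF less.prems(1)] bilinear_radd[OF less.prems(1)]
      bilinear_lmul[OF less.prems(1)] bilinear_rmul[OF less.prems(1)]
      bilinear_lsub[OF less.prems(1)] bilinear_rsub[OF less.prems(1)]
    obtain u where u: "B u u > 0"
      using False less.prems(3) by (metis order_le_less)
    define s where "s = sqrt (B u u)"
    have s: "s > 0" "s * s = B u u" using u by (auto simp: s_def)
    define \<phi> where "\<phi> v = B u v / s" for v
    have \<phi>: "linear \<phi>"
      by (rule linearI) (simp_all add: \<phi>_def bil add_divide_distrib)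
    \<comment> \<open>The Riesz representative of \<open>\<phi>\<close> for the ambient inner
      product.\<close>
    define \<eta> where "\<eta> = adjoint \<phi> 1"
    have \<eta>: "\<eta> \<bullet> v = \<phi> v" for v
      unfolding \<eta>_def by (subst inner_commute, subst adjoint_works[OF \<phi>]) simp
    define B' where "B' v w = B v w - \<phi> v * \<phi> w" for v w
    have bil': "bilinear B'"
      unfolding bilinear_def
      by (intro conjI allI linearI)
        (simp_all add: B'_def bil linear_add[OF \<phi>] linear_cmul[OF \<phi>] algebra_simps)
    have sym': "B' x y = B' y x" for x y
      using less.prems(2)[of x y] by (simp add: B'_def mult.commute)
    have psd: "0 \<le> B' v v" for v
    proof -
      \<comment> \<open>The minimiser of the quadratic polynomial
        \<open>B (v - t *\<^sub>R u) (v - t *\<^sub>R u)\<close> in \<open>t\<close>.\<close>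
      define t where "t = B u v / B u u"
      have t: "t * B u u = B u v" using u by (simp add: t_def)
      have "0 \<le> B (v - t *\<^sub>R u) (v - t *\<^sub>R u)" by (rule less.prems(3))
      also have "\<dots> = B v v - t * B u v - (t * B u v - t * (t * B u u))"
        by (simp add: bil less.prems(2)[of v u] right_diff_distrib)
      also have "\<dots> = B v v - t * B u v" by (simp add: t)
      also have "t * B u v = \<phi> v * \<phi> v" using s by (simp add: t_def \<phi>_def field_simps)
      finally show ?thesis by (simp add: B'_def)
    qed
    let ?N = "\<lambda>B::'v \<Rightarrow> 'v \<Rightarrow> real. {v. \<forall>w. B v w = 0}"
    have sub: "subspace (?N B)"
      unfolding subspace_def
      by (auto simp: bil bilinear_lzero[OF less.prems(1)])
    have sub': "subspace (?N B')"
      unfolding subspace_def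
      by (auto simp: bilinear_ladd[OF bil'] bilinear_lmul[OF bil'] bilinear_lzero[OF bil'])
    have "?N B \<subset> ?N B'"
    proof
      show "?N B \<subseteq> ?N B'"
        using less.prems(2) by (auto simp: B'_def \<phi>_def)
      have "\<phi> u = s" using s u by (simp add: \<phi>_def field_simps)
      then have "B' u w = 0" for w
        using s(1) by (simp add: B'_def) (simp add: \<phi>_def)
      moreover have "u \<notin> ?N B" using u by (auto intro!: exI[of _ u])
      ultimately show "?N B \<noteq> ?N B'" by blast
    qed
    then have "dim (?N B) < dim (?N B')"
      using dim_psubset[of "?N B" "?N B'"] span_eq_iff[THEN iffD2, OF sub] span_eq_iff[THEN iffD2, OF sub']
      by simp
    moreover have "dim (?N B') \<le> DIM('v)" by (rule dim_subset_UNIV)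
    ultimately have "DIM('v) - dim (?N B') < DIM('v) - dim (?N B)" by linarith
    then obtain k :: nat and \<xi> where k: "\<forall>v. B' v v = (\<Sum>j<k. (\<xi> j \<bullet> v)\<^sup>2)"
      using less.hyps[OF _ bil' sym' psd] by blast
    have "B v v = (\<Sum>j<Suc k. ((\<xi>(k := \<eta>)) j \<bullet> v)\<^sup>2)" for v
      using k[THEN spec, of v] by (simp add: B'_def \<eta> power2_eq_square)
    then show ?thesis by blast
  qed
qed

section \<open>Independent standard normal coordinates\<close>

definition gaussian :: "'i set \<Rightarrow> ('i \<Rightarrow> real) measure" where
  "gaussian J = PiM J (\<lambda>_. density lborel std_normal_density)"

lemma prob_space_gaussian: "prob_space (gaussian J)"
  unfolding gaussian_def by (intro prob_space_PiM prob_space_normal_density) simp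

lemma measurable_gaussian_component [measurable]:
  "j \<in> J \<Longrightarrow> (\<lambda>\<omega>. \<omega> j) \<in> borel_measurable (gaussian J)"
  unfolding gaussian_def
  using measurable_component_singleton[of j J "\<lambda>_. density lborel std_normal_density"]
  by (simp add: measurable_def)

lemma distr_gaussian_component:
  assumes "j \<in> J"
  shows "distr (gaussian J) borel (\<lambda>\<omega>. \<omega> j) = density lborel std_normal_density"
proof -
  have "distr (gaussian J) borel (\<lambda>\<omega>. \<omega> j) = distr (gaussian J) (density lborel std_normal_density) (\<lambda>\<omega>. \<omega> j)"
    by (rule distr_cong) auto
  also have "\<dots> = density lborel std_normal_density"
    unfolding gaussian_def
    by (rule distr_PiM_component) (auto intro: prob_space_normal_density assms)
  finally show ?thesis .
qed

lemma distributed_gaussian_component: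
  assumes "j \<in> J"
  shows "distributed (gaussian J) lborel (\<lambda>\<omega>. \<omega> j) std_normal_density"
proof -
  have "distr (gaussian J) lborel (\<lambda>\<omega>. \<omega> j) = distr (gaussian J) borel (\<lambda>\<omega>. \<omega> j)"
    by (rule distr_cong) auto
  then show ?thesis
    unfolding distributed_def using assms by (simp add: distr_gaussian_component)
qed

lemma indep_vars_gaussian:
  assumes "J \<noteq> {}"
  shows "prob_space.indep_vars (gaussian J) (\<lambda>_. borel) (\<lambda>j \<omega>. \<omega> j) J"
proof -
  interpret prob_space "gaussian J" by (rule prob_space_gaussian)
  have "distr (gaussian J) (\<Pi>\<^sub>M i\<in>J. borel) (\<lambda>\<omega>. \<lambda>i\<in>J. \<omega> i) = distr (gaussian J) (gaussian J) (\<lambda>\<omega>. \<omega>)"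
    by (rule distr_cong) (auto simp: gaussian_def space_PiM PiE_restrict intro!: sets_PiM_cong)
  also have "\<dots> = gaussian J" by (rule distr_id)
  also have "\<dots> = (\<Pi>\<^sub>M i\<in>J. distr (gaussian J) borel (\<lambda>\<omega>. \<omega> i))"
    unfolding gaussian_def[of J] by (rule PiM_cong) (simp_all add: distr_gaussian_component[unfolded gaussian_def])
  finally show ?thesis
    by (subst indep_vars_iff_distr_eq_PiM'[OF assms]) auto
qed

lemma integrable_gaussian_component:
  assumes "j \<in> J"
  shows "integrable (gaussian J) (\<lambda>\<omega>. \<omega> j)"
  using distributed_gaussian_component[OF assms]
  by (rule distributed_integrable_var) (use integrable_std_normal_moment[of 1] in auto)

text \<open>The sum is centred normal with variance \<open>\<Sum>j\<in>J. (a j)\<^sup>2\<close>, and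
  \<open>sqrt (2 / pi)\<close> is the mean absolute value of a standard normal variable.\<close>

lemma gaussian_expectation_abs_sum:
  assumes "finite J"
  shows "(\<integral>\<omega>. \<bar>\<Sum>j\<in>J. \<omega> j * a j\<bar> \<partial>gaussian J) = sqrt (2 / pi) * sqrt (\<Sum>j\<in>J. (a j)\<^sup>2)"
proof -
  interpret prob_space "gaussian J" by (rule prob_space_gaussian)
  \<comment> \<open>Zero coefficients are dropped because their terms have no normal
    density.\<close>
  define I where "I = {j \<in> J. a j \<noteq> 0}"
  have I: "finite I" "I \<subseteq> J" using assms by (auto simp: I_def)
  have 1: "(\<Sum>j\<in>J. \<omega> j * a j) = (\<Sum>j\<in>I. a j * \<omega> j)" for \<omega>
    by (rule sum.mono_neutral_cong_right) (use assms in \<open>auto simp: I_def\<close>)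
  have 2: "(\<Sum>j\<in>J. (a j)\<^sup>2) = (\<Sum>j\<in>I. \<bar>a j\<bar>\<^sup>2)"
    by (rule sum.mono_neutral_cong_right) (use assms in \<open>auto simp: I_def\<close>)
  show ?thesis
  proof (cases "I = {}")
    case True
    then show ?thesis unfolding 1 2 by simp
  next
    case False
    define \<sigma> where "\<sigma> = sqrt (\<Sum>j\<in>I. \<bar>a j\<bar>\<^sup>2)"
    have \<sigma>: "\<sigma> > 0"
      unfolding \<sigma>_def real_sqrt_gt_0_iff using I False by (intro sum_pos) (auto simp: I_def)
    have "indep_vars (\<lambda>_. borel) (\<lambda>j \<omega>. \<omega> j) I"
      by (rule indep_vars_subset[OF indep_vars_gaussian]) (use I False in auto)
    then have "indep_vars (\<lambda>_. borel) (\<lambda>j \<omega>. a j * \<omega> j) I"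
      by (rule indep_vars_compose2[where Y = "\<lambda>j x. a j * x"]) simp
    moreover have "distributed (gaussian J) lborel (\<lambda>\<omega>. a j * \<omega> j) (normal_density 0 \<bar>a j\<bar>)" if "j \<in> I" for j
      using normal_density_affine[OF distributed_gaussian_component[of j J], of "a j" 0] that
      by (auto simp: I_def)
    ultimately have D: "distributed (gaussian J) lborel (\<lambda>\<omega>. \<Sum>j\<in>I. a j * \<omega> j) (normal_density 0 \<sigma>)"
      using sum_indep_normal[of I "\<lambda>j \<omega>. a j * \<omega> j" "\<lambda>j. \<bar>a j\<bar>" "\<lambda>_. 0"] I False
      by (auto simp: I_def \<sigma>_def)
    have "(\<integral>\<omega>. \<bar>\<Sum>j\<in>I. a j * \<omega> j\<bar> \<partial>gaussian J) = (\<integral>x. normal_density 0 \<sigma> x * \<bar>x\<bar> \<partial>lborel)"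
      by (rule distributed_integral[OF D, symmetric]) auto
    also have "\<dots> = \<sigma> * sqrt (2 / pi)"
      using integral_normal_moment_abs_odd[OF \<sigma>, of 0 0] by simp
    finally show ?thesis unfolding 1 2 \<sigma>_def by simp
  qed
qed

lemma emeasure_std_normal_interval_pos:
  assumes "a < b"
  shows "emeasure (density lborel std_normal_density) {a<..<b} > 0"
proof (rule ccontr)
  assume "\<not> ?thesis"
  then have "(\<integral>\<^sup>+x. ennreal (std_normal_density x) * indicator {a<..<b} x \<partial>lborel) = 0"
    by (simp add: emeasure_density)
  then have "AE x in lborel. ennreal (std_normal_density x) * indicator {a<..<b} x = 0"
    by (subst (asm) nn_integral_0_iff_AE) auto
  then have "AE x in lborel. x \<notin> {a<..<b}"
  proof eventually_elim
    case (elim x)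
    have "0 < std_normal_density x" by (rule normal_density_pos) simp
    with elim show ?case by (auto simp: indicator_def split: if_splits)
  qed
  then have "emeasure lborel {a<..<b} = 0"
    using AE_iff_measurable[of "{a<..<b}" lborel "\<lambda>x. x \<notin> {a<..<b}"]
    by (simp add: greaterThanLessThan_eq Int_def)
  with assms show False by simp
qed

text \<open>By continuity \<open>W\<close> is positive on a ball around the image of
  \<open>c\<close>. A small box around \<open>c\<close> is mapped into this ball, and every open box
  has positive Gaussian mass.\<close>

lemma gaussian_integral_pos:
  fixes W :: "'v::euclidean_space \<Rightarrow> real"
  assumes "finite J" and W: "continuous_on UNIV W" "\<And>x. 0 \<le> W x"
    and int: "integrable (gaussian J) (\<lambda>\<omega>. W (\<Sum>j\<in>J. \<omega> j *\<^sub>R \<xi> j))"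
    and pos: "W (\<Sum>j\<in>J. c j *\<^sub>R \<xi> j) > 0"
  shows "0 < (\<integral>\<omega>. W (\<Sum>j\<in>J. \<omega> j *\<^sub>R \<xi> j) \<partial>gaussian J)"
proof (rule ccontr)
  assume "\<not> ?thesis"
  moreover have "0 \<le> (\<integral>\<omega>. W (\<Sum>j\<in>J. \<omega> j *\<^sub>R \<xi> j) \<partial>gaussian J)"
    by (rule Bochner_Integration.integral_nonneg) (rule W)
  ultimately have "(\<integral>\<omega>. W (\<Sum>j\<in>J. \<omega> j *\<^sub>R \<xi> j) \<partial>gaussian J) = 0" by linarith
  then have ae: "AE \<omega> in gaussian J. W (\<Sum>j\<in>J. \<omega> j *\<^sub>R \<xi> j) = 0"
    using integral_nonneg_eq_0_iff_AE[OF int] W(2) by simp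
  \<comment> \<open>The summand 1 makes \<open>S\<close> positive and the final distance estimate
    strict, also for empty \<open>J\<close>.\<close>
  define S where "S = (\<Sum>j\<in>J. norm (\<xi> j)) + 1"
  have S: "S > 0" unfolding S_def by (smt (verit) norm_ge_zero sum_nonneg)
  obtain d where d: "d > 0" "\<And>x. dist x (\<Sum>j\<in>J. c j *\<^sub>R \<xi> j) < d \<Longrightarrow> W x > 0"
  proof -
    obtain d where "d > 0" "\<And>x. dist x (\<Sum>j\<in>J. c j *\<^sub>R \<xi> j) < d \<Longrightarrow>
        dist (W x) (W (\<Sum>j\<in>J. c j *\<^sub>R \<xi> j)) < W (\<Sum>j\<in>J. c j *\<^sub>R \<xi> j)"
      using W(1) pos unfolding continuous_on_iff by blast
    then show ?thesis
      by (intro that[of d]) (fastforce simp: dist_real_def)+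
  qed
  define r where "r = d / S"
  have r: "r > 0" "r * S = d" using d S by (auto simp: r_def)
  define Q where "Q = Pi\<^sub>E J (\<lambda>j. {c j - r<..<c j + r})"
  have near: "W (\<Sum>j\<in>J. \<omega> j *\<^sub>R \<xi> j) > 0" if "\<omega> \<in> Q" for \<omega>
  proof (rule d(2))
    have "dist (\<Sum>j\<in>J. \<omega> j *\<^sub>R \<xi> j) (\<Sum>j\<in>J. c j *\<^sub>R \<xi> j) = norm (\<Sum>j\<in>J. (\<omega> j - c j) *\<^sub>R \<xi> j)"
      by (simp add: dist_norm sum_subtractf scaleR_diff_left)
    also have "\<dots> \<le> (\<Sum>j\<in>J. r * norm (\<xi> j))"
    proof (rule sum_norm_le)
      fix j assume "j \<in> J"
      with that have "c j - r < \<omega> j" "\<omega> j < c j + r" by (auto simp: Q_def PiE_iff)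
      then show "norm ((\<omega> j - c j) *\<^sub>R \<xi> j) \<le> r * norm (\<xi> j)"
        by (auto intro!: mult_right_mono)
    qed
    also have "\<dots> < r * S" using r by (simp add: S_def sum_distrib_left distrib_left)
    finally show "dist (\<Sum>j\<in>J. \<omega> j *\<^sub>R \<xi> j) (\<Sum>j\<in>J. c j *\<^sub>R \<xi> j) < d" by (simp add: r)
  qed
  interpret product_prob_space "\<lambda>_. density lborel std_normal_density" J
    by (intro product_prob_spaceI prob_space_normal_density) simp
  have "emeasure (gaussian J) Q = (\<Prod>j\<in>J. emeasure (density lborel std_normal_density) {c j - r<..<c j + r})"
    unfolding gaussian_def Q_def by (rule emeasure_PiM) (use assms in auto)
  also have "\<dots> \<noteq> 0"
    using \<open>finite J\<close> emeasure_std_normal_interval_pos r(1)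
    by (auto simp: less_le)
  finally have "emeasure (gaussian J) Q \<noteq> 0" .
  moreover have "Q \<in> sets (gaussian J)"
    unfolding gaussian_def Q_def using \<open>finite J\<close> by (intro sets_PiM_I_finite) auto
  moreover have "AE \<omega> in gaussian J. \<omega> \<notin> Q"
    using ae by eventually_elim (use near in force)
  ultimately show False
    using AE_iff_null_sets[of Q "gaussian J"] by (simp add: null_sets_def)
qed

section \<open>Planar seminorms\<close>

text \<open>Lets a sum over all directions start at the direction of evaluation, where the sines
  then have constant sign.\<close>

lemma sum_lessThan_shift_periodic:
  fixes h :: "nat \<Rightarrow> 'b::ab_group_add"
  assumes "\<And>j. h (j + n) = h j"
  shows "(\<Sum>i<n. h (k + i)) = (\<Sum>i<n. h i)"
proof (induction k)
  case (Suc k)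
  have "h k + (\<Sum>i<n. h (Suc k + i)) = (\<Sum>i<Suc n. h (k + i))"
    by (subst sum.lessThan_Suc_shift) simp
  also have "\<dots> = (\<Sum>i<n. h (k + i)) + h k"
    using assms[of k] by simp
  finally show ?case using Suc by simp
qed simp

text \<open>Summation by parts against \<open>sin\<close>, which is annihilated by the second difference operator
  \<open>F \<mapsto> F (\<theta> - \<alpha>) + F (\<theta> + \<alpha>) - 2 cos \<alpha> F \<theta>\<close>.\<close>

lemma sum_second_difference_sin:
  fixes F :: "real \<Rightarrow> real"
  shows "(\<Sum>i<m. (F (\<theta> + real i * \<alpha> - \<alpha>) + F (\<theta> + real i * \<alpha> + \<alpha>) - 2 * cos \<alpha> * F (\<theta> + real i * \<alpha>))
      * sin (real i * \<alpha>))
    = F (\<theta> + real m * \<alpha>) * sin (real m * \<alpha> - \<alpha>) - F (\<theta> + real m * \<alpha> - \<alpha>) * sin (real m * \<alpha>)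
      + F \<theta> * sin \<alpha>"
proof (induction m)
  case (Suc m)
  define x where "x = real m * \<alpha>"
  have x: "real (Suc m) * \<alpha> = x + \<alpha>" by (simp add: x_def algebra_simps)
  have s: "sin (x + \<alpha>) = 2 * cos \<alpha> * sin x - sin (x - \<alpha>)"
    by (simp add: sin_add sin_diff)
  show ?case
    unfolding sum.lessThan_Suc Suc x x_def[symmetric] s
    by (simp add: algebra_simps)
qed simp

lemma DIM_2_basis:
  assumes "DIM('v::euclidean_space) = 2"
  obtains e1 e2 :: "'v::euclidean_space" where "Basis = {e1, e2}" "e1 \<noteq> e2"
    "e1 \<bullet> e1 = 1" "e2 \<bullet> e2 = 1" "e1 \<bullet> e2 = 0" "e2 \<bullet> e1 = 0"
    "\<And>v. (v \<bullet> e1) *\<^sub>R e1 + (v \<bullet> e2) *\<^sub>R e2 = v"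
proof -
  obtain e1 e2 :: 'v where e: "Basis = {e1, e2}" "e1 \<noteq> e2"
    using assms by (auto simp: card_2_iff)
  then have m: "e1 \<in> Basis" "e2 \<in> Basis" by blast+
  have "(v \<bullet> e1) *\<^sub>R e1 + (v \<bullet> e2) *\<^sub>R e2 = v" for v
    using euclidean_representation[of v, unfolded e(1)] e(2) by simp
  moreover have "e1 \<bullet> e1 = 1" "e2 \<bullet> e2 = 1" "e1 \<bullet> e2 = 0" "e2 \<bullet> e1 = 0"
    using m e(2) by (simp_all add: inner_Basis)
  ultimately show ?thesis using that e by blast
qed

text \<open>In the plane, the piecewise linear interpolation of \<open>p\<close> along the directions \<open>j\<pi>/n\<close> has this
  form, with the second differences of \<open>p\<close> as coefficients.\<close>

lemma seminorm_approx_sum_abs_inner: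
  fixes p :: "'v::euclidean_space \<Rightarrow> real"
  assumes p: "is_seminorm p" and dim: "DIM('v) \<le> 2" and "e > 0"
  obtains m :: nat and \<xi> where "\<And>v. \<bar>p v - (\<Sum>j<m. \<bar>\<xi> j \<bullet> v\<bar>)\<bar> \<le> e * norm v"
proof (cases "DIM('v) = 1")
  case True
  then obtain b :: 'v where b: "Basis = {b}" by (auto simp: card_1_singleton_iff)
  have pv: "\<bar>(p b *\<^sub>R b) \<bullet> v\<bar> = p v" for v
  proof -
    have "(v \<bullet> b) *\<^sub>R b = v"
      using euclidean_representation[of v, unfolded b] by simp
    then show ?thesis
      using is_seminorm_scaleR[OF p, of "v \<bullet> b" b] is_seminorm_nonneg[OF p, of b]
      by (simp add: abs_mult inner_commute)
  qed
  show ?thesis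
  proof (rule that[where m = 1 and \<xi> = "\<lambda>_. p b *\<^sub>R b"])
    show "\<bar>p v - (\<Sum>j<1::nat. \<bar>(p b *\<^sub>R b) \<bullet> v\<bar>)\<bar> \<le> e * norm v" for v
      unfolding pv using \<open>e > 0\<close> by simp
  qed
next
  case False
  then have "DIM('v) = 2" using dim DIM_positive[where 'a = 'v] by linarith
  then obtain e1 e2 :: 'v where e: "Basis = {e1, e2}" "e1 \<noteq> e2"
    and ee: "e1 \<bullet> e1 = 1" "e2 \<bullet> e2 = 1" "e1 \<bullet> e2 = 0" "e2 \<bullet> e1 = 0"
    and rep: "\<And>v. (v \<bullet> e1) *\<^sub>R e1 + (v \<bullet> e2) *\<^sub>R e2 = v"
    using DIM_2_basis by blast
  define u where "u \<theta> = cos \<theta> *\<^sub>R e1 + sin \<theta> *\<^sub>R e2" for \<theta>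
  define n where "n \<theta> = (- sin \<theta>) *\<^sub>R e1 + cos \<theta> *\<^sub>R e2" for \<theta>
  define L where "L = p e1 + p e2"
  have L: "L \<ge> 0" by (simp add: L_def is_seminorm_nonneg[OF p])
  \<comment> \<open>Chosen to give \<open>2 * L * \<alpha> \<le> e\<close>. The half circle is cut
    into an even number \<open>2 * N\<close> of steps so that \<open>e2\<close>, at angle
    \<open>pi / 2\<close>, is a node like \<open>e1\<close>; hence \<open>q\<close> agrees with
    \<open>p\<close> on the basis and gets the same constant \<open>L\<close>.\<close>
  define N where "N = Suc (nat \<lceil>L * pi / e\<rceil>)"
  define \<alpha> where "\<alpha> = pi / (2 * real N)"
  have N0: "real N > 0" by (simp add: N_def)
  have "real N \<ge> L * pi / e" unfolding N_def by linarith
  then have La: "2 * L * \<alpha> \<le> e"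
    using \<open>e > 0\<close> N0 by (simp add: \<alpha>_def field_simps)
  have a0: "0 < \<alpha>" "\<alpha> \<le> pi / 2" using N0 by (auto simp: \<alpha>_def N_def field_simps)
  have Na: "real (2 * N) * \<alpha> = pi" "real N * \<alpha> = pi / 2" using N0 by (auto simp: \<alpha>_def)
  have sa: "sin \<alpha> > 0" using a0 by (intro sin_gt_zero) auto
  have ca: "cos \<alpha> \<ge> 0" using a0 by (intro cos_ge_zero) auto
  define F where "F \<theta> = p (u \<theta>)" for \<theta>
  have Fpi: "F (\<theta> + pi) = F \<theta>" for \<theta>
  proof -
    have "u (\<theta> + pi) = - u \<theta>" by (simp add: u_def)
    then show ?thesis by (simp add: F_def is_seminorm_minus[OF p])
  qed
  define D where "D \<theta> = F (\<theta> - \<alpha>) + F (\<theta> + \<alpha>) - 2 * cos \<alpha> * F \<theta>" for \<theta>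
  \<comment> \<open>The triangle inequality for two unit vectors at angles
    \<open>\<theta> - \<alpha>\<close> and \<open>\<theta> + \<alpha>\<close>, whose sum is
    \<open>2 * cos \<alpha>\<close> times the one between them.\<close>
  have D0: "D \<theta> \<ge> 0" for \<theta>
  proof -
    have "u (\<theta> - \<alpha>) + u (\<theta> + \<alpha>) = (2 * cos \<alpha>) *\<^sub>R u \<theta>"
    proof -
      have "u (\<theta> - \<alpha>) + u (\<theta> + \<alpha>)
          = (cos (\<theta> - \<alpha>) + cos (\<theta> + \<alpha>)) *\<^sub>R e1 + (sin (\<theta> - \<alpha>) + sin (\<theta> + \<alpha>)) *\<^sub>R e2"
        by (simp add: u_def scaleR_add_left)
      also have "cos (\<theta> - \<alpha>) + cos (\<theta> + \<alpha>) = 2 * cos \<alpha> * cos \<theta>"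
        by (simp add: cos_add cos_diff)
      also have "sin (\<theta> - \<alpha>) + sin (\<theta> + \<alpha>) = 2 * cos \<alpha> * sin \<theta>"
        by (simp add: sin_add sin_diff)
      finally show ?thesis by (simp add: u_def scaleR_add_right)
    qed
    then show ?thesis
      using is_seminorm_triangle[OF p, of "u (\<theta> - \<alpha>)" "u (\<theta> + \<alpha>)"]
        is_seminorm_scaleR[OF p, of "2 * cos \<alpha>" "u \<theta>"] ca
      by (simp add: D_def F_def)
  qed
  \<comment> \<open>The function \<open>\<bar>n \<theta> \<bullet> v\<bar>\<close> has its kink
    along the line of \<open>u \<theta>\<close>, and \<open>D \<theta>\<close> measures the kink
    required there.\<close>
  define \<xi> where "\<xi> j = (D (real j * \<alpha>) / (2 * sin \<alpha>)) *\<^sub>R n (real j * \<alpha>)" for j :: nat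
  define q where "q v = (\<Sum>j<2*N. \<bar>\<xi> j \<bullet> v\<bar>)" for v
  have q: "is_seminorm q"
    unfolding q_def by (rule is_seminorm_sum_abs_inner)
  have nu: "n \<theta> \<bullet> u \<phi> = sin (\<phi> - \<theta>)" for \<theta> \<phi>
    by (simp add: n_def u_def inner_add_left inner_diff_left inner_add_right ee sin_diff mult.commute)
  have q_eq: "q (u (real k * \<alpha>)) = p (u (real k * \<alpha>))" for k :: nat
  proof -
    define h where "h j = D (real j * \<alpha>) * \<bar>sin (real j * \<alpha> - real k * \<alpha>)\<bar>" for j :: nat
    have "h (j + 2 * N) = h j" for j
    proof -
      have *: "real (j + 2 * N) * \<alpha> = real j * \<alpha> + pi"
        using Na by (simp add: algebra_simps)
      have "D (real j * \<alpha> + pi) = D (real j * \<alpha>)"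
        using Fpi[of "real j * \<alpha> - \<alpha>"] Fpi[of "real j * \<alpha> + \<alpha>"] Fpi[of "real j * \<alpha>"]
        by (simp add: D_def algebra_simps)
      moreover have "\<bar>sin (real j * \<alpha> + pi - real k * \<alpha>)\<bar> = \<bar>sin (real j * \<alpha> - real k * \<alpha>)\<bar>"
        using sin_periodic_pi[of "real j * \<alpha> - real k * \<alpha>"] by (simp add: algebra_simps)
      ultimately show ?thesis unfolding h_def * by simp
    qed
    from sum_lessThan_shift_periodic[of h, OF this]
    have shift: "(\<Sum>j<2*N. h j) = (\<Sum>i<2*N. h (k + i))" by simp
    have "h (k + i) = D (real k * \<alpha> + real i * \<alpha>) * sin (real i * \<alpha>)" if "i < 2 * N" for i
    proof -
      have "real i * \<alpha> \<le> real (2 * N) * \<alpha>" using that a0(1) by (intro mult_right_mono) auto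
      then have "sin (real i * \<alpha>) \<ge> 0" unfolding Na(1) using a0(1) by (intro sin_ge_zero) auto
      then show ?thesis by (simp add: h_def algebra_simps)
    qed
    then have "(\<Sum>j<2*N. h j) = (\<Sum>i<2*N. D (real k * \<alpha> + real i * \<alpha>) * sin (real i * \<alpha>))"
      unfolding shift by (intro sum.cong) auto
    \<comment> \<open>Over half a turn \<open>sin pi\<close> kills one boundary term and the
      periodicity of \<open>F\<close> makes the other two equal; this is the origin of the
      normalisation \<open>2 * sin \<alpha>\<close>.\<close>
    also have "\<dots> = F (real k * \<alpha> + pi) * sin (pi - \<alpha>) - F (real k * \<alpha> + pi - \<alpha>) * sin pi
        + F (real k * \<alpha>) * sin \<alpha>"
      unfolding D_def sum_second_difference_sin Na(1) ..
    also have "\<dots> = 2 * sin \<alpha> * F (real k * \<alpha>)" by (simp add: Fpi)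
    finally have sum_h: "(\<Sum>j<2*N. h j) = 2 * sin \<alpha> * F (real k * \<alpha>)" .
    have "\<bar>\<xi> j \<bullet> u (real k * \<alpha>)\<bar> = h j / (2 * sin \<alpha>)" for j
    proof -
      have "\<bar>sin (real k * \<alpha> - real j * \<alpha>)\<bar> = \<bar>sin (real j * \<alpha> - real k * \<alpha>)\<bar>"
        by (metis abs_minus_cancel minus_diff_eq sin_minus)
      then show ?thesis
        using D0[of "real j * \<alpha>"] sa by (simp add: \<xi>_def nu h_def abs_mult)
    qed
    then have "q (u (real k * \<alpha>)) = (\<Sum>j<2*N. h j) / (2 * sin \<alpha>)"
      by (simp add: q_def sum_divide_distrib)
    then show ?thesis using sa by (simp add: sum_h F_def)
  qed
  have "u 0 = e1" "u (pi / 2) = e2" by (auto simp: u_def)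
  then have qe: "q e1 = p e1" "q e2 = p e2"
    using q_eq[of 0] q_eq[of N] unfolding Na by simp_all
  have pL: "p v \<le> L * norm v" and qL: "q v \<le> L * norm v" for v
    using is_seminorm_le_norm[OF p, of v, unfolded e(1)] is_seminorm_le_norm[OF q, of v, unfolded e(1)]
      e(2) qe by (simp_all add: L_def)
  \<comment> \<open>Both seminorms agree at the last node before \<open>\<phi>\<close>; the chord
    from there has length at most \<open>\<alpha>\<close>, so each of them changes by at most
    \<open>L * \<alpha>\<close>.\<close>
  have unit: "\<bar>p (u \<phi>) - q (u \<phi>)\<bar> \<le> e" if "\<phi> \<ge> 0" for \<phi>
  proof -
    define k where "k = nat \<lfloor>\<phi> / \<alpha>\<rfloor>"
    have "real k = of_int \<lfloor>\<phi> / \<alpha>\<rfloor>" using that a0 by (simp add: k_def)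
    then have "real k \<le> \<phi> / \<alpha>" "\<phi> / \<alpha> < real k + 1" by linarith+
    then have k: "0 \<le> \<phi> - real k * \<alpha>" "\<phi> - real k * \<alpha> \<le> \<alpha>"
      using a0 by (auto simp: field_simps)
    define \<delta> where "\<delta> = \<phi> - real k * \<alpha>"
    define d where "d = u \<phi> - u (real k * \<alpha>)"
    have "(norm d)\<^sup>2 = (cos \<phi> - cos (real k * \<alpha>))\<^sup>2 + (sin \<phi> - sin (real k * \<alpha>))\<^sup>2"
      unfolding power2_norm_eq_inner
      by (simp add: d_def u_def inner_add_left inner_add_right inner_diff_left inner_diff_right ee
          power2_eq_square algebra_simps)
    also have "\<dots> = ((cos \<phi>)\<^sup>2 + (sin \<phi>)\<^sup>2) + ((cos (real k * \<alpha>))\<^sup>2 + (sin (real k * \<alpha>))\<^sup>2)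
        - 2 * (cos \<phi> * cos (real k * \<alpha>) + sin \<phi> * sin (real k * \<alpha>))"
      by (simp add: power2_eq_square algebra_simps)
    also have "\<dots> = 2 - 2 * cos \<delta>" unfolding \<delta>_def cos_diff by simp
    also have "\<dots> = 2 - 2 * cos (2 * (\<delta> / 2))" by simp
    also have "\<dots> = (2 * sin (\<delta> / 2))\<^sup>2"
      unfolding cos_double_sin by (simp add: power2_eq_square)
    finally have "norm d = \<bar>2 * sin (\<delta> / 2)\<bar>"
      by (metis norm_ge_zero real_sqrt_abs real_sqrt_unique)
    also have "\<dots> \<le> \<bar>\<delta>\<bar>" using abs_sin_x_le_abs_x[of "\<delta> / 2"] by simp
    also have "\<dots> \<le> \<alpha>" using k by (simp add: \<delta>_def)
    finally have "L * norm d \<le> L * \<alpha>" using L by (rule mult_left_mono)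
    moreover have "\<bar>p (u \<phi>) - p (u (real k * \<alpha>))\<bar> \<le> p d" "\<bar>q (u \<phi>) - q (u (real k * \<alpha>))\<bar> \<le> q d"
      unfolding d_def by (rule is_seminorm_diff[OF p] is_seminorm_diff[OF q])+
    ultimately show ?thesis using pL[of d] qL[of d] q_eq[of k] La by linarith
  qed
  have "\<bar>p v - q v\<bar> \<le> e * norm v" for v
  proof (cases "v = 0")
    case True
    then show ?thesis by (simp add: is_seminorm_0[OF p] is_seminorm_0[OF q])
  next
    case False
    have "(norm v)\<^sup>2 = (v \<bullet> e1)\<^sup>2 + (v \<bullet> e2)\<^sup>2"
      unfolding power2_norm_eq_inner using euclidean_inner[of v v, unfolded e(1)] e(2) by (simp add: power2_eq_square)
    then have "((v \<bullet> e1)\<^sup>2 + (v \<bullet> e2)\<^sup>2) / (norm v)\<^sup>2 = 1"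
      using False by (metis divide_self norm_eq_zero power2_eq_square mult_eq_0_iff)
    then have "(v \<bullet> e1 / norm v)\<^sup>2 + (v \<bullet> e2 / norm v)\<^sup>2 = 1"
      by (simp add: power_divide add_divide_distrib)
    then obtain \<phi> where \<phi>: "\<phi> \<ge> 0" "v \<bullet> e1 / norm v = cos \<phi>" "v \<bullet> e2 / norm v = sin \<phi>"
      using sincos_total_2pi by blast
    then have "v \<bullet> e1 = norm v * cos \<phi>" "v \<bullet> e2 = norm v * sin \<phi>"
      using False by (auto simp: field_simps)
    with rep[of v] have "norm v *\<^sub>R u \<phi> = v" by (simp add: u_def scaleR_add_right)
    then have "p v = norm v * p (u \<phi>)" "q v = norm v * q (u \<phi>)"
      using is_seminorm_scaleR[OF p, of "norm v" "u \<phi>"] is_seminorm_scaleR[OF q, of "norm v" "u \<phi>"] by auto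
    then have "\<bar>p v - q v\<bar> = norm v * \<bar>p (u \<phi>) - q (u \<phi>)\<bar>"
      by (simp add: abs_mult flip: right_diff_distrib)
    also have "\<dots> \<le> norm v * e" using unit[OF \<phi>(1)] by (intro mult_left_mono) auto
    finally show ?thesis by (simp add: mult.commute)
  qed
  then show ?thesis using that unfolding q_def by blast
qed

text \<open>Strict convexity at the direction orthogonal to \<open>\<xi>\<^sub>0\<close> forces every approximating sum to
  carry weight near \<open>\<xi>\<^sub>0\<close>: the functions \<open>v \<mapsto> \<bar>\<xi> \<bullet> v\<bar>\<close> with \<open>\<xi>\<close> away from the line through
  \<open>\<xi>\<^sub>0\<close> are additive on a narrow cone around that direction.\<close>

lemma strictly_convex_sum_lower_bound:
  fixes p :: "'v::euclidean_space \<Rightarrow> real"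
  assumes p: "strictly_convex_norm p" and dim: "DIM('v) \<le> 2"
    and W: "continuous_on UNIV W" "\<And>x. 0 \<le> W x" "\<And>c x. W (c *\<^sub>R x) = \<bar>c\<bar> * W x" and "W \<xi>\<^sub>0 > 0"
  obtains c e :: real where "c > 0" "e > 0"
    "\<And>(m::nat) \<xi>. (\<And>v. \<bar>p v - (\<Sum>j<m. \<bar>\<xi> j \<bullet> v\<bar>)\<bar> \<le> e * norm v) \<Longrightarrow> c \<le> (\<Sum>j<m. W (\<xi> j))"
proof (cases "DIM('v) = 1")
  case True
  then obtain b :: 'v where b: "Basis = {b}" by (auto simp: card_1_singleton_iff)
  then have "b \<in> Basis" by blast
  then have b1: "norm b = 1" "b \<noteq> 0" by (auto dest: nonzero_Basis)
  have pn: "is_seminorm p" "p b \<noteq> 0"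
    using p b1 by (auto simp: strictly_convex_norm_def is_norm_fun_def)
  then have pb: "p b > 0" using is_seminorm_nonneg[of p b] by linarith
  have Wb: "W x = \<bar>x \<bullet> b\<bar> * W b" for x
    using W(3)[of "x \<bullet> b" b] euclidean_representation[of x, unfolded b] by simp
  then have Wb0: "W b > 0" using \<open>W \<xi>\<^sub>0 > 0\<close> W(2)[of b] by (metis less_eq_real_def mult_zero_right)
  show ?thesis
  proof (rule that[where c = "p b / 2 * W b" and e = "p b / 2"])
    fix m :: nat and \<xi> assume "\<And>v. \<bar>p v - (\<Sum>j<m. \<bar>\<xi> j \<bullet> v\<bar>)\<bar> \<le> p b / 2 * norm v"
    from this[of b] have "\<bar>p b - (\<Sum>j<m. \<bar>\<xi> j \<bullet> b\<bar>)\<bar> \<le> p b / 2" unfolding b1 by simp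
    then have "p b / 2 \<le> (\<Sum>j<m. \<bar>\<xi> j \<bullet> b\<bar>)" unfolding abs_le_iff by linarith
    then have "p b / 2 * W b \<le> (\<Sum>j<m. \<bar>\<xi> j \<bullet> b\<bar>) * W b" using Wb0 by (intro mult_right_mono) auto
    also have "\<dots> = (\<Sum>j<m. W (\<xi> j))" unfolding sum_distrib_right by (simp only: Wb[symmetric])
    finally show "p b / 2 * W b \<le> (\<Sum>j<m. W (\<xi> j))" .
  qed (use pb Wb0 in auto)
next
  case False
  then have "DIM('v) = 2" using dim DIM_positive[where 'a = 'v] by linarith
  then obtain e1 e2 :: 'v where e: "Basis = {e1, e2}" "e1 \<noteq> e2"
    and ee: "e1 \<bullet> e1 = 1" "e2 \<bullet> e2 = 1" "e1 \<bullet> e2 = 0" "e2 \<bullet> e1 = 0"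
    and rep: "\<And>v. (v \<bullet> e1) *\<^sub>R e1 + (v \<bullet> e2) *\<^sub>R e2 = v"
    using DIM_2_basis by blast
  have \<xi>0: "\<xi>\<^sub>0 \<noteq> 0" using W(3)[of 0 0] \<open>W \<xi>\<^sub>0 > 0\<close> by auto
  define x where "x = \<xi>\<^sub>0 \<bullet> e1"
  define y where "y = \<xi>\<^sub>0 \<bullet> e2"
  define r where "r = x * x + y * y"
  \<comment> \<open>\<open>\<xi>\<^sub>0\<close> turned by a right angle.\<close>
  define f where "f = (- y) *\<^sub>R e1 + x *\<^sub>R e2"
  have x0: "\<xi>\<^sub>0 = x *\<^sub>R e1 + y *\<^sub>R e2" by (simp add: x_def y_def rep)
  have r: "r > 0" using \<xi>0 x0 unfolding r_def
    by (metis add.right_neutral scaleR_zero_left sum_squares_gt_zero_iff)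
  have ip: "\<xi>\<^sub>0 \<bullet> \<xi>\<^sub>0 = r" "f \<bullet> f = r" "\<xi>\<^sub>0 \<bullet> f = 0" "f \<bullet> \<xi>\<^sub>0 = 0"
    by (auto simp: x0 f_def inner_add_left inner_add_right ee r_def algebra_simps)
  have dec: "\<exists>s t. v = s *\<^sub>R \<xi>\<^sub>0 + t *\<^sub>R f" for v
  proof -
    define s where "s = ((v \<bullet> e1) * x + (v \<bullet> e2) * y) / r"
    define t where "t = ((v \<bullet> e2) * x - (v \<bullet> e1) * y) / r"
    have "s * x - t * y = (v \<bullet> e1) * r / r" "s * y + t * x = (v \<bullet> e2) * r / r"
      unfolding s_def t_def r_def by (simp_all add: algebra_simps flip: add_divide_distrib diff_divide_distrib)
    then have "s * x - t * y = v \<bullet> e1" "s * y + t * x = v \<bullet> e2" using r by auto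
    moreover have "s *\<^sub>R \<xi>\<^sub>0 + t *\<^sub>R f = (s * x - t * y) *\<^sub>R e1 + (s * y + t * x) *\<^sub>R e2"
      by (simp add: x0 f_def algebra_simps)
    ultimately show ?thesis using rep[of v] by metis
  qed
  define \<delta> where "\<delta> = W \<xi>\<^sub>0 / 2"
  have \<delta>: "\<delta> > 0" using \<open>W \<xi>\<^sub>0 > 0\<close> by (simp add: \<delta>_def)
  obtain \<rho> where \<rho>: "\<rho> > 0" "\<And>z. dist z \<xi>\<^sub>0 < \<rho> \<Longrightarrow> dist (W z) (W \<xi>\<^sub>0) < \<delta>"
    using W(1) \<delta> unfolding continuous_on_iff by blast
  define \<eta> where "\<eta> = \<rho> / norm f"
  have f0: "norm f > 0" using ip r by auto
  have \<eta>: "\<eta> > 0" using \<rho> f0 by (simp add: \<eta>_def)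
  have near: "W (\<xi>\<^sub>0 + t *\<^sub>R f) \<ge> \<delta>" if "\<bar>t\<bar> < \<eta>" for t
  proof -
    have "dist (\<xi>\<^sub>0 + t *\<^sub>R f) \<xi>\<^sub>0 < \<rho>"
      using that f0 by (simp add: \<eta>_def dist_norm field_simps)
    from \<rho>(2)[OF this] show ?thesis unfolding dist_real_def \<delta>_def by linarith
  qed
  \<comment> \<open>The cone is matched to \<open>near\<close>: for
    \<open>\<xi> = s *\<^sub>R \<xi>\<^sub>0 + t *\<^sub>R f\<close>, additivity at \<open>a\<close>
    and \<open>b\<close> fails only if \<open>\<bar>t\<bar> < \<bar>s\<bar> * \<eta>\<close>, and
    then \<open>\<xi>\<close> is \<open>s\<close> times a point where \<open>W\<close> is at least
    \<open>\<delta>\<close>.\<close>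
  define a where "a = f - \<eta> *\<^sub>R \<xi>\<^sub>0"
  define b where "b = f + \<eta> *\<^sub>R \<xi>\<^sub>0"
  have ineq: "\<delta> * (\<bar>\<xi> \<bullet> a\<bar> + \<bar>\<xi> \<bullet> b\<bar> - \<bar>\<xi> \<bullet> (a + b)\<bar>) \<le> 2 * \<eta> * r * W \<xi>" for \<xi>
  proof -
    obtain s t where st: "\<xi> = s *\<^sub>R \<xi>\<^sub>0 + t *\<^sub>R f" using dec by blast
    have xa: "\<xi> \<bullet> a = r * (t - s * \<eta>)" and xb: "\<xi> \<bullet> b = r * (t + s * \<eta>)" and xab: "\<xi> \<bullet> (a + b) = r * (2 * t)"
      by (simp_all add: st a_def b_def inner_add_left inner_add_right inner_diff_right ip algebra_simps)
    have lhs: "\<bar>\<xi> \<bullet> a\<bar> + \<bar>\<xi> \<bullet> b\<bar> - \<bar>\<xi> \<bullet> (a + b)\<bar> = r * (\<bar>t - s * \<eta>\<bar> + \<bar>t + s * \<eta>\<bar> - 2 * \<bar>t\<bar>)"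
      unfolding xa xb xab abs_mult using r by (simp add: distrib_left right_diff_distrib)
    have sh: "\<bar>s * \<eta>\<bar> = \<bar>s\<bar> * \<eta>" using \<eta> by (simp add: abs_mult)
    show ?thesis
    proof (cases "\<bar>t\<bar> < \<bar>s\<bar> * \<eta>")
      case False
      then have "\<bar>t - s * \<eta>\<bar> + \<bar>t + s * \<eta>\<bar> - 2 * \<bar>t\<bar> = 0" using sh by linarith
      then show ?thesis unfolding lhs using W(2)[of \<xi>] \<eta> r by simp
    next
      case True
      then have s0: "s \<noteq> 0" by auto
      have "\<xi> = s *\<^sub>R (\<xi>\<^sub>0 + (t / s) *\<^sub>R f)" using s0 by (simp add: st scaleR_add_right)
      then have "W \<xi> = \<bar>s\<bar> * W (\<xi>\<^sub>0 + (t / s) *\<^sub>R f)" using W(3) by simp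
      moreover have "W (\<xi>\<^sub>0 + (t / s) *\<^sub>R f) \<ge> \<delta>"
        using True s0 by (intro near) (simp add: abs_divide field_simps)
      ultimately have Ws: "\<bar>s\<bar> * \<delta> \<le> W \<xi>" by (simp add: mult_left_mono)
      have "\<bar>t - s * \<eta>\<bar> + \<bar>t + s * \<eta>\<bar> - 2 * \<bar>t\<bar> \<le> 2 * \<bar>s\<bar> * \<eta>" using sh by linarith
      then have "\<delta> * (r * (\<bar>t - s * \<eta>\<bar> + \<bar>t + s * \<eta>\<bar> - 2 * \<bar>t\<bar>)) \<le> \<delta> * (r * (2 * \<bar>s\<bar> * \<eta>))"
        using \<delta> r by (intro mult_left_mono) auto
      also have "\<dots> = 2 * \<eta> * r * (\<bar>s\<bar> * \<delta>)" by simp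
      also have "\<dots> \<le> 2 * \<eta> * r * W \<xi>" using Ws \<eta> r by (intro mult_left_mono) auto
      finally show ?thesis unfolding lhs .
    qed
  qed
  define d where "d = p a + p b - p (a + b)"
  have d: "d > 0"
  proof -
    have "s = 0 \<and> t = 0" if "s *\<^sub>R a + t *\<^sub>R b = 0" for s t
    proof -
      have "(s *\<^sub>R a + t *\<^sub>R b) \<bullet> f = (s + t) * r" "(s *\<^sub>R a + t *\<^sub>R b) \<bullet> \<xi>\<^sub>0 = (t - s) * \<eta> * r"
        by (simp_all add: a_def b_def inner_add_left inner_diff_left ip algebra_simps)
      with that r \<eta> show ?thesis by simp
    qed
    then show ?thesis using p by (simp add: strictly_convex_norm_def d_def)
  qed
  define S where "S = norm a + norm b + norm (a + b)"
  have S: "S \<ge> 0" by (simp add: S_def)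
  \<comment> \<open>The three approximation errors total at most \<open>d / 2\<close>, so half of
    the defect \<open>d\<close> survives for every admissible sum; \<open>c\<close> is what
    \<open>ineq\<close> makes of this half.\<close>
  show ?thesis
  proof (rule that[where c = "\<delta> * (d / 2) / (2 * \<eta> * r)" and e = "d / (2 * (S + 1))"])
    fix m :: nat and \<xi> :: "nat \<Rightarrow> 'v"
    define \<epsilon> where "\<epsilon> = d / (2 * (S + 1))"
    define q where "q v = (\<Sum>j<m. \<bar>\<xi> j \<bullet> v\<bar>)" for v
    assume "\<And>v. \<bar>p v - (\<Sum>j<m. \<bar>\<xi> j \<bullet> v\<bar>)\<bar> \<le> d / (2 * (S + 1)) * norm v"
    then have approx: "\<bar>p v - q v\<bar> \<le> \<epsilon> * norm v" for v
      by (simp only: q_def \<epsilon>_def)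
    have "\<epsilon> * S \<le> d / 2"
      using S d by (simp add: \<epsilon>_def field_simps)
    then have "\<epsilon> * norm a + \<epsilon> * norm b + \<epsilon> * norm (a + b) \<le> d / 2"
      by (simp add: S_def distrib_left)
    then have "d / 2 \<le> q a + q b - q (a + b)"
      using approx[of a] approx[of b] approx[of "a + b"] d_def by linarith
    then have "\<delta> * (d / 2) \<le> \<delta> * (q a + q b - q (a + b))" using \<delta> by (intro mult_left_mono) auto
    also have "\<dots> = (\<Sum>j<m. \<delta> * (\<bar>\<xi> j \<bullet> a\<bar> + \<bar>\<xi> j \<bullet> b\<bar> - \<bar>\<xi> j \<bullet> (a + b)\<bar>))"
      by (simp add: q_def sum.distrib sum_subtractf sum_distrib_left right_diff_distrib distrib_left)
    also have "\<dots> \<le> (\<Sum>j<m. 2 * \<eta> * r * W (\<xi> j))" by (intro sum_mono ineq)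
    finally show "\<delta> * (d / 2) / (2 * \<eta> * r) \<le> (\<Sum>j<m. W (\<xi> j))"
      using \<eta> r by (simp add: sum_distrib_left[symmetric] field_simps)
  qed (use \<delta> d \<eta> r S in auto)
qed

section \<open>Comparison of total variations\<close>

lemma total_variation_finite:
  fixes \<mu> :: "'a set \<Rightarrow> 'v::euclidean_space"
  assumes \<mu>: "vector_measure M \<mu>" and p: "is_seminorm p"
  obtains T where "total_variation p M \<mu> (space M) = ereal T"
proof -
  have "total_variation (\<lambda>_. 0) M \<mu> (space M) \<le> 0"
    by (rule total_variation_leI) simp
  moreover have "total_variation p M \<mu> (space M) \<le> total_variation (\<lambda>_. 0) M \<mu> (space M)
      + ereal ((\<Sum>b\<in>Basis. p b) * (\<Sum>b\<in>Basis. width (vm_range M \<mu>) b))"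
    by (rule total_variation_mono[OF \<mu>])
      (use is_seminorm_le_norm[OF p] is_seminorm_nonneg[OF p] in \<open>auto intro: sum_nonneg\<close>)
  moreover have "ereal 0 \<le> total_variation p M \<mu> (space M)"
    using sum_le_total_variation[of "{}::nat set" "\<lambda>_. {}" M "space M" p \<mu>] by (simp add: disjoint_family_on_def)
  ultimately show ?thesis
    using that by (cases "total_variation p M \<mu> (space M)"; cases "total_variation (\<lambda>_. 0) M \<mu> (space M)") auto
qed

lemma total_variation_sum_abs_inner:
  fixes \<mu> :: "'a set \<Rightarrow> 'v::euclidean_space" and \<xi> :: "nat \<Rightarrow> 'v"
  assumes \<mu>: "vector_measure M \<mu>"
  shows "total_variation (\<lambda>v. \<Sum>j<m. \<bar>\<xi> j \<bullet> v\<bar>) M \<mu> (space M)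
    = ereal (\<Sum>j<m. width (vm_range M \<mu>) (\<xi> j))"
proof -
  \<comment> \<open>A finite sum is an integral against counting measure.\<close>
  have "integrable (count_space {..<m}) \<xi>"
    by (rule integrable_count_space) simp
  from total_variation_eq_integral_width(2)[OF \<mu> this, of "\<lambda>v. \<Sum>j<m. \<bar>\<xi> j \<bullet> v\<bar>"] show ?thesis
    by (simp add: lebesgue_integral_count_space_finite)
qed

lemma width_vm_range_gap:
  fixes \<nu> \<mu> :: "'a set \<Rightarrow> 'v::euclidean_space"
  assumes "vector_measure M \<nu>" "vector_measure M \<mu>" "vm_range M \<nu> \<subset> vm_range M \<mu>"
  obtains \<xi> where "width (vm_range M \<nu>) \<xi> < width (vm_range M \<mu>) \<xi>"
proof -
  obtain z where "z \<in> vm_range M \<mu>" "z \<notin> vm_range M \<nu>" using assms(3) by blast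
  with width_less[OF compact_vm_range[OF assms(1)] convex_vm_range vm_range_nonempty bounded_vm_range[OF assms(2)]]
    assms(3) that show ?thesis by blast
qed

lemma euclidean_total_variation_compare:
  fixes p :: "'v::euclidean_space \<Rightarrow> real" and \<nu> \<mu> :: "'a set \<Rightarrow> 'v"
  assumes p: "is_euclidean_norm p" and \<nu>: "vector_measure M \<nu>" and \<mu>: "vector_measure M \<mu>"
    and sub: "vm_range M \<nu> \<subseteq> vm_range M \<mu>"
  shows "total_variation p M \<nu> (space M) \<le> total_variation p M \<mu> (space M)"
    and "vm_range M \<nu> \<noteq> vm_range M \<mu> \<Longrightarrow> total_variation p M \<nu> (space M) < total_variation p M \<mu> (space M)"
proof -
  obtain B :: "'v \<Rightarrow> 'v \<Rightarrow> real" where B: "bilinear B" "\<And>x y. B x y = B y x"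
    and Bpos: "\<And>x. x \<noteq> 0 \<Longrightarrow> B x x > 0" and pB: "\<And>x. p x = sqrt (B x x)"
    using p unfolding is_euclidean_norm_def by blast
  have "0 \<le> B x x" for x
    using Bpos[of x] bilinear_lzero[OF B(1), of 0] by (cases "x = 0") auto
  then obtain k :: nat and \<zeta> where \<zeta>: "\<And>v. B v v = (\<Sum>j<k. (\<zeta> j \<bullet> v)\<^sup>2)"
    using psd_form_eq_sum_squares[OF B] by blast
  \<comment> \<open>The factor cancels the mean absolute value \<open>sqrt (2 / pi)\<close>.\<close>
  define \<xi> where "\<xi> j = sqrt (pi / 2) *\<^sub>R \<zeta> j" for j
  define f where "f \<omega> = (\<Sum>j<k. \<omega> j *\<^sub>R \<xi> j)" for \<omega> :: "nat \<Rightarrow> real"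
  let ?G = "gaussian {..<k}"
  let ?w = "\<lambda>\<mu>. width (vm_range M \<mu>)"
  have f: "integrable ?G f"
    unfolding f_def
    by (intro Bochner_Integration.integrable_sum integrable_scaleR_left integrable_gaussian_component) simp
  have sumsq: "(\<Sum>j<k. (\<xi> j \<bullet> v)\<^sup>2) = pi / 2 * B v v" for v
    by (simp add: \<xi>_def \<zeta> power_mult_distrib sum_distrib_left)
  have pf: "p v = (\<integral>\<omega>. \<bar>f \<omega> \<bullet> v\<bar> \<partial>?G)" for v
  proof -
    have "(\<integral>\<omega>. \<bar>f \<omega> \<bullet> v\<bar> \<partial>?G) = (\<integral>\<omega>. \<bar>\<Sum>j<k. \<omega> j * (\<xi> j \<bullet> v)\<bar> \<partial>?G)"
      by (simp add: f_def inner_sum_left)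
    also have "\<dots> = sqrt (2 / pi) * sqrt (\<Sum>j<k. (\<xi> j \<bullet> v)\<^sup>2)"
      by (rule gaussian_expectation_abs_sum) simp
    also note sumsq
    also have "sqrt (2 / pi) * sqrt (pi / 2 * B v v) = sqrt (2 / pi * (pi / 2 * B v v))"
      by (rule real_sqrt_mult[symmetric])
    also have "2 / pi * (pi / 2 * B v v) = B v v" by simp
    finally show ?thesis by (simp add: pB)
  qed
  note tv = total_variation_eq_integral_width[OF _ f pf]
  have le: "?w \<nu> x \<le> ?w \<mu> x" for x
    by (rule width_mono[OF bounded_vm_range[OF \<mu>] sub vm_range_nonempty])
  show "total_variation p M \<nu> (space M) \<le> total_variation p M \<mu> (space M)"
    unfolding tv(2)[OF \<nu>] tv(2)[OF \<mu>] ereal_less_eq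
    by (intro integral_mono tv(1)[OF \<nu>] tv(1)[OF \<mu>] le)
  assume "vm_range M \<nu> \<noteq> vm_range M \<mu>"
  with sub have "vm_range M \<nu> \<subset> vm_range M \<mu>" by blast
  from width_vm_range_gap[OF \<nu> \<mu> this]
  obtain \<xi>\<^sub>0 where gap: "?w \<nu> \<xi>\<^sub>0 < ?w \<mu> \<xi>\<^sub>0" .
  define W where "W x = ?w \<mu> x - ?w \<nu> x" for x
  \<comment> \<open>The operator of the form \<open>pi / 2 * B\<close>. Definiteness makes it
    injective, hence surjective, so \<open>\<xi>\<^sub>0\<close> is a combination of the
    \<open>\<xi> j\<close> and the Gaussian vector charges its neighbourhoods.\<close>
  have lin: "linear (\<lambda>v. \<Sum>j<k. (\<xi> j \<bullet> v) *\<^sub>R \<xi> j)"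
    by (rule linearI) (simp_all add: inner_add_right scaleR_add_left sum.distrib scaleR_sum_right)
  have "inj (\<lambda>v. \<Sum>j<k. (\<xi> j \<bullet> v) *\<^sub>R \<xi> j)"
    unfolding linear_injective_0[OF lin]
  proof (intro allI impI)
    fix v assume "(\<Sum>j<k. (\<xi> j \<bullet> v) *\<^sub>R \<xi> j) = 0"
    then have "0 = (\<Sum>j<k. (\<xi> j \<bullet> v) *\<^sub>R \<xi> j) \<bullet> v" by simp
    also have "\<dots> = (\<Sum>j<k. (\<xi> j \<bullet> v)\<^sup>2)" by (simp add: inner_sum_left power2_eq_square)
    also have "\<dots> = pi / 2 * B v v" by (rule sumsq)
    finally show "v = 0" using Bpos[of v] by auto
  qed
  from surjD[OF linear_injective_imp_surjective[OF lin this], of \<xi>\<^sub>0]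
  obtain v where v: "(\<Sum>j<k. (\<xi> j \<bullet> v) *\<^sub>R \<xi> j) = \<xi>\<^sub>0" by metis
  have "0 < (\<integral>\<omega>. W (\<Sum>j<k. \<omega> j *\<^sub>R \<xi> j) \<partial>?G)"
  proof (rule gaussian_integral_pos)
    show "continuous_on UNIV W"
      unfolding W_def
      by (intro continuous_on_diff continuous_on_seminorm is_seminorm_width_vm_range \<nu> \<mu>)
    show "0 \<le> W x" for x using le[of x] by (simp add: W_def)
    show "integrable ?G (\<lambda>\<omega>. W (\<Sum>j<k. \<omega> j *\<^sub>R \<xi> j))"
      unfolding W_def f_def[symmetric] by (intro Bochner_Integration.integrable_diff tv(1) \<nu> \<mu>)
    show "W (\<Sum>j<k. (\<xi> j \<bullet> v) *\<^sub>R \<xi> j) > 0" using gap by (simp add: v W_def)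
  qed simp
  also have "\<dots> = (\<integral>\<omega>. ?w \<mu> (f \<omega>) \<partial>?G) - (\<integral>\<omega>. ?w \<nu> (f \<omega>) \<partial>?G)"
    unfolding W_def f_def[symmetric] by (intro Bochner_Integration.integral_diff tv(1) \<nu> \<mu>)
  finally show "total_variation p M \<nu> (space M) < total_variation p M \<mu> (space M)"
    unfolding tv(2)[OF \<nu>] tv(2)[OF \<mu>] by simp
qed

text \<open>The passage to the limit, done once for both claims: \<open>c = 0\<close> yields the
  inequality and a positive \<open>c\<close> its strict form. The premise is uniform over all
  approximations of quality \<open>e\<^sub>0\<close>, since \<open>c\<close> must survive as the
  error tends to zero.\<close>

lemma planar_total_variation_gap:
  fixes p :: "'v::euclidean_space \<Rightarrow> real" and \<nu> \<mu> :: "'a set \<Rightarrow> 'v"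
  assumes p: "is_seminorm p" and dim: "DIM('v) \<le> 2"
    and \<nu>: "vector_measure M \<nu>" and \<mu>: "vector_measure M \<mu>" and "e\<^sub>0 > 0"
    and c: "\<And>(m::nat) \<xi>. (\<And>v. \<bar>p v - (\<Sum>j<m. \<bar>\<xi> j \<bullet> v\<bar>)\<bar> \<le> e\<^sub>0 * norm v) \<Longrightarrow>
      c \<le> (\<Sum>j<m. width (vm_range M \<mu>) (\<xi> j) - width (vm_range M \<nu>) (\<xi> j))"
  shows "total_variation p M \<nu> (space M) + ereal c \<le> total_variation p M \<mu> (space M)"
proof -
  obtain S where S: "total_variation p M \<nu> (space M) = ereal S" by (rule total_variation_finite[OF \<nu> p])
  obtain T where T: "total_variation p M \<mu> (space M) = ereal T" by (rule total_variation_finite[OF \<mu> p])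
  define K where "K = (\<Sum>b\<in>Basis. width (vm_range M \<nu>) b) + (\<Sum>b\<in>Basis. width (vm_range M \<mu>) b)"
  have K: "K \<ge> 0"
    unfolding K_def
    by (intro add_nonneg_nonneg sum_nonneg is_seminorm_nonneg is_seminorm_width_vm_range \<nu> \<mu>)
  have "S + c \<le> T"
  proof (rule field_le_epsilon)
    fix \<epsilon> :: real assume \<epsilon>: "\<epsilon> > 0"
    define e where "e = min e\<^sub>0 (\<epsilon> / (K + 1))"
    have e: "e > 0" using \<epsilon> K \<open>e\<^sub>0 > 0\<close> by (simp add: e_def)
    have "e * K \<le> \<epsilon> / (K + 1) * K" using K by (intro mult_right_mono) (auto simp: e_def)
    also have "\<dots> \<le> \<epsilon>" using K \<epsilon> by (simp add: field_simps)
    finally have eK: "e * K \<le> \<epsilon>" .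
    obtain m :: nat and \<xi> where m: "\<And>v. \<bar>p v - (\<Sum>j<m. \<bar>\<xi> j \<bullet> v\<bar>)\<bar> \<le> e * norm v"
      using seminorm_approx_sum_abs_inner[OF p dim e] by blast
    have "e * norm v \<le> e\<^sub>0 * norm v" for v :: 'v by (intro mult_right_mono) (auto simp: e_def)
    with m have "\<bar>p v - (\<Sum>j<m. \<bar>\<xi> j \<bullet> v\<bar>)\<bar> \<le> e\<^sub>0 * norm v" for v by (meson order_trans)
    from c[OF this] have 1: "c \<le> (\<Sum>j<m. width (vm_range M \<mu>) (\<xi> j)) - (\<Sum>j<m. width (vm_range M \<nu>) (\<xi> j))"
      by (simp add: sum_subtractf)
    have "p v \<le> (\<Sum>j<m. \<bar>\<xi> j \<bullet> v\<bar>) + e * norm v" "(\<Sum>j<m. \<bar>\<xi> j \<bullet> v\<bar>) \<le> p v + e * norm v" for v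
      using m[of v] by linarith+
    note total_variation_mono[OF \<nu> this(1)] total_variation_mono[OF \<mu> this(2)]
    then have "S \<le> (\<Sum>j<m. width (vm_range M \<nu>) (\<xi> j)) + e * (\<Sum>b\<in>Basis. width (vm_range M \<nu>) b)"
      and "(\<Sum>j<m. width (vm_range M \<mu>) (\<xi> j)) \<le> T + e * (\<Sum>b\<in>Basis. width (vm_range M \<mu>) b)"
      using e unfolding total_variation_sum_abs_inner[OF \<nu>] total_variation_sum_abs_inner[OF \<mu>] S T
      by simp_all
    with 1 eK show "S + c \<le> T + \<epsilon>"
      unfolding K_def distrib_left by linarith
  qed
  then show ?thesis by (simp add: S T)
qed

lemma planar_total_variation_compare:
  fixes p :: "'v::euclidean_space \<Rightarrow> real" and \<nu> \<mu> :: "'a set \<Rightarrow> 'v"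
  assumes p: "is_seminorm p" and dim: "DIM('v) \<le> 2" and \<nu>: "vector_measure M \<nu>" and \<mu>: "vector_measure M \<mu>"
    and sub: "vm_range M \<nu> \<subseteq> vm_range M \<mu>"
  shows "total_variation p M \<nu> (space M) \<le> total_variation p M \<mu> (space M)"
    and "strictly_convex_norm p \<Longrightarrow> vm_range M \<nu> \<noteq> vm_range M \<mu> \<Longrightarrow>
      total_variation p M \<nu> (space M) < total_variation p M \<mu> (space M)"
proof -
  define W where "W x = width (vm_range M \<mu>) x - width (vm_range M \<nu>) x" for x
  have W0: "0 \<le> W x" for x
    unfolding W_def using width_mono[OF bounded_vm_range[OF \<mu>] sub vm_range_nonempty] by simp
  show "total_variation p M \<nu> (space M) \<le> total_variation p M \<mu> (space M)"
  proof -
    have "total_variation p M \<nu> (space M) + ereal 0 \<le> total_variation p M \<mu> (space M)"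
      by (rule planar_total_variation_gap[OF p dim \<nu> \<mu> zero_less_one])
        (unfold W_def[symmetric], rule sum_nonneg[OF W0])
    then show ?thesis by simp
  qed
  assume sc: "strictly_convex_norm p" and "vm_range M \<nu> \<noteq> vm_range M \<mu>"
  with sub have "vm_range M \<nu> \<subset> vm_range M \<mu>" by blast
  from width_vm_range_gap[OF \<nu> \<mu> this] obtain \<xi>\<^sub>0 where gap: "W \<xi>\<^sub>0 > 0"
    unfolding W_def by (metis diff_gt_0_iff_gt)
  have cont: "continuous_on UNIV W"
    unfolding W_def
    by (intro continuous_on_diff continuous_on_seminorm is_seminorm_width_vm_range \<nu> \<mu>)
  have hom: "W (c *\<^sub>R x) = \<bar>c\<bar> * W x" for c x
    unfolding W_def is_seminorm_scaleR[OF is_seminorm_width_vm_range[OF \<mu>]]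
      is_seminorm_scaleR[OF is_seminorm_width_vm_range[OF \<nu>]] right_diff_distrib ..
  obtain c e :: real where "c > 0" and "e > 0"
    and c: "\<And>(m::nat) \<xi>. (\<And>v. \<bar>p v - (\<Sum>j<m. \<bar>\<xi> j \<bullet> v\<bar>)\<bar> \<le> e * norm v) \<Longrightarrow> c \<le> (\<Sum>j<m. W (\<xi> j))"
  proof (rule strictly_convex_sum_lower_bound[OF sc dim cont W0 hom gap])
    fix c e :: real
    assume "c > 0" "e > 0"
      and "\<And>(m::nat) \<xi>. (\<And>v. \<bar>p v - (\<Sum>j<m. \<bar>\<xi> j \<bullet> v\<bar>)\<bar> \<le> e * norm v) \<Longrightarrow> c \<le> (\<Sum>j<m. W (\<xi> j))"
    then show thesis by (rule that[of c e])
  qed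
  have "total_variation p M \<nu> (space M) + ereal c \<le> total_variation p M \<mu> (space M)"
    by (rule planar_total_variation_gap[OF p dim \<nu> \<mu> \<open>e > 0\<close>]) (unfold W_def[symmetric], rule c)
  moreover obtain S where "total_variation p M \<nu> (space M) = ereal S"
    by (rule total_variation_finite[OF \<nu> p])
  ultimately show "total_variation p M \<nu> (space M) < total_variation p M \<mu> (space M)"
    using \<open>c > 0\<close> by (cases "total_variation p M \<mu> (space M)") auto
qed

theorem theorem1p4:
  fixes p :: "'v::euclidean_space \<Rightarrow> real"
    and M :: "'a measure"
    and \<nu> \<mu> :: "'a set \<Rightarrow> 'v"
  assumes "is_seminorm p"
    and "DIM('v) \<le> 2 \<or> is_euclidean_norm p"
    and "vector_measure M \<nu>" and "vector_measure M \<mu>"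
    and "vm_range M \<nu> \<subseteq> vm_range M \<mu>"
  shows "total_variation p M \<nu> (space M) \<le> total_variation p M \<mu> (space M)
    \<and> (strictly_convex_norm p \<longrightarrow>
        (total_variation p M \<nu> (space M) = total_variation p M \<mu> (space M)
          \<longleftrightarrow> vm_range M \<nu> = vm_range M \<mu>))"
proof -
  \<comment> \<open>Stated for arbitrary measures because equal ranges call for it in both
    directions.\<close>
  have le: "total_variation p M \<kappa> (space M) \<le> total_variation p M \<mu>' (space M)"
    if "vector_measure M \<kappa>" "vector_measure M \<mu>'" "vm_range M \<kappa> \<subseteq> vm_range M \<mu>'"
    for \<kappa> \<mu>' :: "'a set \<Rightarrow> 'v"
    using assms(2) planar_total_variation_compare(1)[OF assms(1) _ that]
      euclidean_total_variation_compare(1)[OF _ that] by blast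
  have "total_variation p M \<nu> (space M) < total_variation p M \<mu> (space M)"
    if "strictly_convex_norm p" "vm_range M \<nu> \<noteq> vm_range M \<mu>"
    using assms(2) planar_total_variation_compare(2)[OF assms(1) _ assms(3-5) that]
      euclidean_total_variation_compare(2)[OF _ assms(3-5) that(2)] by blast
  moreover have "total_variation p M \<nu> (space M) = total_variation p M \<mu> (space M)"
    if "vm_range M \<nu> = vm_range M \<mu>"
    using le[OF assms(3,4)] le[OF assms(4,3)] that by (simp add: order_antisym)
  ultimately show ?thesis
    using le[OF assms(3-5)] by fastforce
qed

end
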